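(* Let $\lambda>0$ be a constant, $X$ a real random variable and $M(t)=\sum_{k=1}^{N(t)}X_k$ a homogeneous compound Poisson process, $M\sim CP(\lambda,X)$. Let $U_1,U_2,\dots$ be i.i.d. uniform on $(0,1)$, independent of $N$ and of $X_1,X_2,\dots$. Then for each fixed $t\ge0$ and each $\alpha\ge0$, $$\int_0^tM(s)(t-s)^\alpha\,ds\ \stackrel{d}{=}\ \frac{t^{\alpha+1}}{\alpha+1}\sum_{k=1}^{N(t)}X_kU_k^{\alpha+1}.$$ Moreover, if $\mathbb{E}X=0$ and $\mathbb{E}X^2<\infty$, then as $t\to\infty$, $$\frac{1}{t^2}\int_0^tM(s)\,ds\ \longrightarrow\ 0\ \text{ in probability},\qquad \frac{1}{t^{3/2}}\int_0^tM(s)\,ds\ \longrightarrow\ Z\sim\mathrm{Normal}\big(0,\lambda\,\mathbb{E}X^2/3\big)\ \text{ in distribution}.$$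
   Context: $M\sim CP(\lambda,X)$ means $M(t)=\sum_{k=1}^{N(t)}X_k$, $t\ge0$, with $N$ a homogeneous Poisson process of rate $\lambda$ and $X_1,X_2,\dots$ i.i.d. copies of $X$, independent of $N$. The symbol $\stackrel{d}{=}$ denotes equality in distribution of random variables; $\mathrm{Normal}(0,\sigma^2)$ has variance $\sigma^2$. *)

theory Defs
  imports "HOL-Probability.Probability"
begin

locale poisson_process = prob_space P
  for P :: "'a measure" and rate :: real and N :: "real \<Rightarrow> 'a \<Rightarrow> nat" +
  assumes rate_pos: "0 < rate"
    and count_measurable: "\<And>t. 0 \<le> t \<Longrightarrow> random_variable (count_space UNIV) (N t)"
    and start_zero: "\<And>\<omega>. \<omega> \<in> space P \<Longrightarrow> N 0 \<omega> = 0"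
    and path_mono: "\<And>\<omega>. \<omega> \<in> space P \<Longrightarrow> mono_on {0..} (\<lambda>t. N t \<omega>)"
    and path_right_continuous:
      "\<And>\<omega> t. \<omega> \<in> space P \<Longrightarrow> 0 \<le> t \<Longrightarrow> continuous (at_right t) (\<lambda>s. N s \<omega>)"
    and increments_indep:
      "\<And>(n::nat) \<tau>::nat \<Rightarrow> real. 0 \<le> \<tau> 0 \<Longrightarrow> (\<And>i. i < n \<Longrightarrow> \<tau> i \<le> \<tau> (Suc i)) \<Longrightarrow>
        indep_vars (\<lambda>_. count_space UNIV) (\<lambda>i \<omega>. N (\<tau> (Suc i)) \<omega> - N (\<tau> i) \<omega>) {..<n}"
    and increments_poisson:
      "\<And>s t. 0 \<le> s \<Longrightarrow> s < t \<Longrightarrow>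
        distr P (count_space UNIV) (\<lambda>\<omega>. N t \<omega> - N s \<omega>) = measure_pmf (poisson_pmf (rate * (t - s)))"

text \<open>Independence of the process from the sequence of jumps is independence of the whole path
  (an element of the product space over times \<open>t \<ge> 0\<close>) from the whole sequence. The jump variable
  \<open>X\<close> may live on a probability space \<open>Q\<close> of its own, since only its law matters.\<close>

abbreviation path_space :: "(real \<Rightarrow> nat) measure" where
  "path_space \<equiv> Pi\<^sub>M {0..} (\<lambda>_. count_space UNIV)"

abbreviation count_path :: "(real \<Rightarrow> 'a \<Rightarrow> nat) \<Rightarrow> 'a \<Rightarrow> real \<Rightarrow> nat" where
  "count_path N \<omega> \<equiv> \<lambda>t\<in>{0..}. N t \<omega>"

abbreviation seq_space :: "(nat \<Rightarrow> real) measure" where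
  "seq_space \<equiv> Pi\<^sub>M {1..} (\<lambda>_. borel)"

abbreviation rv_seq :: "(nat \<Rightarrow> 'a \<Rightarrow> real) \<Rightarrow> 'a \<Rightarrow> nat \<Rightarrow> real" where
  "rv_seq Y \<omega> \<equiv> \<lambda>k\<in>{1..}. Y k \<omega>"

text \<open>\<^const>\<open>prob_space.indep_var\<close> requires both random elements to take values in the same type;
  the following is its analogue for two value types.\<close>

definition (in prob_space) indep_elements ::
    "'b measure \<Rightarrow> ('a \<Rightarrow> 'b) \<Rightarrow> 'c measure \<Rightarrow> ('a \<Rightarrow> 'c) \<Rightarrow> bool" where
  "indep_elements S Y T Z \<longleftrightarrow>
    random_variable S Y \<and> random_variable T Z \<and>
    indep_set {Y -` A \<inter> space M | A. A \<in> sets S} {Z -` B \<inter> space M | B. B \<in> sets T}"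

locale compound_poisson = poisson_process P rate N + jump: prob_space Q
  for P :: "'a measure" and rate :: real and N :: "real \<Rightarrow> 'a \<Rightarrow> nat"
    and Q :: "'b measure" and X :: "'b \<Rightarrow> real" and Xs :: "nat \<Rightarrow> 'a \<Rightarrow> real" +
  assumes jump_measurable: "X \<in> borel_measurable Q"
    and jumps_indep: "indep_vars (\<lambda>_. borel) Xs {1..}"
    and jumps_distr: "\<And>k. 1 \<le> k \<Longrightarrow> distr P borel (Xs k) = distr Q borel X"
    and jumps_indep_count: "indep_elements path_space (count_path N) seq_space (rv_seq Xs)"

definition compound_sum :: "(real \<Rightarrow> 'a \<Rightarrow> nat) \<Rightarrow> (nat \<Rightarrow> 'a \<Rightarrow> real) \<Rightarrow> real \<Rightarrow> 'a \<Rightarrow> real" where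
  "compound_sum N Xs t \<omega> = (\<Sum>k = 1..N t \<omega>. Xs k \<omega>)"

text \<open>\<^const>\<open>distr\<close> is only meaningful for measurable maps, hence the measurability conjuncts here
  and in the modes of convergence below.\<close>

definition eq_in_distribution :: "'a measure \<Rightarrow> ('a \<Rightarrow> real) \<Rightarrow> 'b measure \<Rightarrow> ('b \<Rightarrow> real) \<Rightarrow> bool" where
  "eq_in_distribution P Y Q Z \<longleftrightarrow>
    Y \<in> borel_measurable P \<and> Z \<in> borel_measurable Q \<and> distr P borel Y = distr Q borel Z"

definition tendsto_in_probability ::
    "'a measure \<Rightarrow> ('i \<Rightarrow> 'a \<Rightarrow> real) \<Rightarrow> ('a \<Rightarrow> real) \<Rightarrow> 'i filter \<Rightarrow> bool" where
  "tendsto_in_probability P Y Z F \<longleftrightarrow>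
    (\<forall>\<^sub>F i in F. Y i \<in> borel_measurable P) \<and> Z \<in> borel_measurable P \<and>
    (\<forall>\<epsilon>>0. ((\<lambda>i. measure P {\<omega> \<in> space P. \<epsilon> < \<bar>Y i \<omega> - Z \<omega>\<bar>}) \<longlongrightarrow> 0) F)"

text \<open>Convergence in distribution to a law, as in \<^const>\<open>weak_conv_m\<close> but along an arbitrary
  filter.\<close>

definition tendsto_in_distribution ::
    "'a measure \<Rightarrow> ('i \<Rightarrow> 'a \<Rightarrow> real) \<Rightarrow> real measure \<Rightarrow> 'i filter \<Rightarrow> bool" where
  "tendsto_in_distribution P Y \<mu> F \<longleftrightarrow>
    (\<forall>\<^sub>F i in F. Y i \<in> borel_measurable P) \<and>
    (\<forall>x. isCont (cdf \<mu>) x \<longrightarrow> ((\<lambda>i. cdf (distr P borel (Y i)) x) \<longlongrightarrow> cdf \<mu> x) F)"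

text \<open>The normal law with mean \<open>m\<close> and variance \<open>v \<ge> 0\<close>. The library's \<^const>\<open>normal_density\<close> takes
  the standard deviation and does not cover the point mass arising for \<open>v = 0\<close>.\<close>

definition normal_law :: "real \<Rightarrow> real \<Rightarrow> real measure" where
  "normal_law m v =
    (if v = 0 then return borel m else density lborel (normal_density m (sqrt v)))"

end

(*
  Idea: both sides of the identity in law have the characteristic function
  exp (rate * t * (psi u - 1)), where psi is the characteristic function of
  t^(alpha+1) / (alpha+1) * X * V^(alpha+1) with V uniform on (0,1) and independent of X.
  For the sum this is conditioning on N(t), X and U in turn. For the integral no order statistics
  of the jump times are needed: right-endpoint Riemann sums converge to it along every path by
  right-continuity, they are linear combinations of values of M at finitely many times, and the
  independent Poisson increments of N turn their characteristic functions into exponentials of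
  Riemann sums for psi.
  With alpha = 0, E X = 0 and s2 = E X^2, the expansion psi(u) = 1 - u^2 s2 / 6 + o(u^2) for X * V
  and Levy's continuity theorem give both limits.
*)
theory Submission
  imports Defs
begin

subsection \<open>Independence and Poisson randomisation\<close>

text \<open>The weight (t-s)^\<alpha> is integrated exactly over every grid cell instead of being
  sampled. A jump in the cell that starts at t j / n is counted at all grid times from the end of
  that cell on, so its total weight is the sum of the weights of this cell and all later ones, which
  telescopes to (t - t j / n)^(\<alpha>+1) / (\<alpha>+1). This is where the power \<alpha>+1 and
  the prefactor come from; the uniform variable is the limit of the remaining time fraction 1 - j /
  n. The exponent for the n-th sum is thus exactly a right-endpoint Riemann sum for psi, and one
  convergence lemma serves the paths and psi alike. With right endpoints it holds at every time,
  jump times included, without any discussion of left limits.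

  The obstacle on the probabilistic side is a product with a random number of factors that
  themselves depend on the path. It is met by freezing the whole path (or the path and all jumps)
  and averaging over the remaining independent sequence.\<close>

text \<open>The argument is complex because it will be a value of a characteristic function.
  Absolute convergence of the exponential series turns the integral into a sum.\<close>

lemma poisson_pmf_pgf:
  fixes z :: complex
  assumes "0 < \<mu>"
  shows "(\<integral>n. z ^ n \<partial>poisson_pmf \<mu>) = exp (of_real \<mu> * (z - 1))"
proof -
  let ?f = "\<lambda>n::nat. (\<mu> ^ n / fact n * exp (- \<mu>)) *\<^sub>R z ^ n"
  have eq: "?f n = exp (- of_real \<mu>) * ((of_real \<mu> * z) ^ n /\<^sub>R fact n)" for n
    by (simp add: scaleR_conv_of_real power_mult_distrib exp_of_real [symmetric] field_simps)
  have sums: "?f sums (exp (- of_real \<mu>) * exp (of_real \<mu> * z))"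
    unfolding eq by (intro sums_mult exp_converges)
  have "summable (\<lambda>n. norm (?f n))"
    unfolding eq norm_mult by (intro summable_mult summable_norm_exp)
  then have int: "integrable (count_space UNIV) ?f"
    by (simp add: integrable_count_space_nat_iff)
  have "(\<integral>n. z ^ n \<partial>poisson_pmf \<mu>) = (\<integral>n. ?f n \<partial>count_space UNIV)"
    using assms by (simp add: measure_pmf_eq_density integral_density)
  also have "\<dots> = (\<Sum>n. ?f n)"
    by (rule integral_count_space_nat [OF int])
  also have "\<dots> = exp (of_real \<mu> * (z - 1))"
    using sums by (simp add: sums_iff algebra_simps flip: exp_add)
  finally show ?thesis .
qed

context prob_space
begin

text \<open>Independence fixes the joint law on measurable rectangles, and these determine a product
  of probability measures.\<close>

lemma indep_elements_distr_pair:
  assumes "indep_elements S Y T Z"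
  shows "distr M (S \<Otimes>\<^sub>M T) (\<lambda>\<omega>. (Y \<omega>, Z \<omega>)) = distr M S Y \<Otimes>\<^sub>M distr M T Z"
proof -
  have [measurable]: "random_variable S Y" "random_variable T Z"
    and indep: "indep_set {Y -` A \<inter> space M | A. A \<in> sets S} {Z -` B \<inter> space M | B. B \<in> sets T}"
    using assms by (auto simp: indep_elements_def)
  interpret Y: prob_space "distr M S Y" by (rule prob_space_distr) simp
  interpret Z: prob_space "distr M T Z" by (rule prob_space_distr) simp
  interpret YZ: pair_prob_space "distr M S Y" "distr M T Z" ..
  show ?thesis
  proof (rule sym, rule pair_measure_eqI)
    fix A B assume "A \<in> sets (distr M S Y)" "B \<in> sets (distr M T Z)"
    then have [measurable]: "A \<in> sets S" "B \<in> sets T" by auto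
    have "prob ((Y -` A \<inter> space M) \<inter> (Z -` B \<inter> space M)) =
        prob (Y -` A \<inter> space M) * prob (Z -` B \<inter> space M)"
      by (rule indep_setD [OF indep]) auto
    moreover have "(\<lambda>\<omega>. (Y \<omega>, Z \<omega>)) -` (A \<times> B) \<inter> space M =
        (Y -` A \<inter> space M) \<inter> (Z -` B \<inter> space M)"
      by auto
    ultimately show "emeasure (distr M S Y) A * emeasure (distr M T Z) B =
        emeasure (distr M (S \<Otimes>\<^sub>M T) (\<lambda>\<omega>. (Y \<omega>, Z \<omega>))) (A \<times> B)"
      by (simp add: emeasure_distr emeasure_eq_measure ennreal_mult)
  qed (auto simp: Y.sigma_finite_measure_axioms Z.sigma_finite_measure_axioms)
qed

text \<open>Fubini for the product of the two laws: \<open>Y\<close> is frozen at one sample point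
  while \<open>Z\<close> is averaged over a second one. The bound by 1 fits the intended integrands,
  products of characters and of characteristic functions.\<close>

lemma indep_elements_integral:
  fixes f :: "'b \<times> 'c \<Rightarrow> complex"
  assumes indep: "indep_elements S Y T Z"
    and f [measurable]: "f \<in> borel_measurable (S \<Otimes>\<^sub>M T)"
    and bound: "\<And>x. norm (f x) \<le> 1"
  shows "expectation (\<lambda>\<omega>. f (Y \<omega>, Z \<omega>)) =
    (\<integral>\<omega>. (\<integral>\<omega>'. f (Y \<omega>, Z \<omega>') \<partial>M) \<partial>M)"
proof -
  have Y [measurable]: "random_variable S Y" and Z [measurable]: "random_variable T Z"
    using indep by (auto simp: indep_elements_def)
  interpret Y: prob_space "distr M S Y" by (rule prob_space_distr) simp
  interpret Z: prob_space "distr M T Z" by (rule prob_space_distr) simp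
  interpret YZ: pair_prob_space "distr M S Y" "distr M T Z" ..
  have "expectation (\<lambda>\<omega>. f (Y \<omega>, Z \<omega>)) =
      integral\<^sup>L (distr M S Y \<Otimes>\<^sub>M distr M T Z) f"
    by (simp add: integral_distr flip: indep_elements_distr_pair [OF indep])
  also have "\<dots> = (\<integral>y. (\<integral>z. f (y, z) \<partial>distr M T Z) \<partial>distr M S Y)"
    by (intro YZ.integral_fst' [symmetric] YZ.P.integrable_const_bound [where B = 1])
      (auto simp: bound)
  also have "\<dots> = (\<integral>\<omega>. (\<integral>\<omega>'. f (Y \<omega>, Z \<omega>') \<partial>M) \<partial>M)"
  proof -
    have "(\<lambda>y. \<integral>z. f (y, z) \<partial>distr M T Z) \<in> borel_measurable S"
      by measurable
    then show ?thesis
      by (subst integral_distr) (auto intro!: Bochner_Integration.integral_cong integral_distr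
          measurable_Pair2 [OF f] measurable_space [OF Y])
  qed
  finally show ?thesis .
qed

text \<open>Once \<open>Z\<close> is frozen, the number of factors and the functions
  \<open>h k z\<close> are deterministic, and independence of the \<open>Y k\<close> factors the
  expectation. In the applications \<open>Z\<close> is the path when jumps are averaged, and the
  path together with the jumps when the uniform variables are.\<close>

lemma indep_elements_random_prod:
  fixes m :: "'b \<Rightarrow> nat" and h :: "nat \<Rightarrow> 'b \<Rightarrow> real \<Rightarrow> complex"
  assumes indep: "indep_elements S Z seq_space (rv_seq Y)"
    and Y_indep: "indep_vars (\<lambda>_. borel) Y {1..}"
    and m [measurable]: "m \<in> measurable S (count_space UNIV)"
    and h [measurable]: "\<And>k. 1 \<le> k \<Longrightarrow> (\<lambda>(z, y). h k z y) \<in> borel_measurable (S \<Otimes>\<^sub>M borel)"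
    and bound: "\<And>k z y. norm (h k z y) \<le> 1"
  shows "expectation (\<lambda>\<omega>. \<Prod>k = 1..m (Z \<omega>). h k (Z \<omega>) (Y k \<omega>)) =
    expectation (\<lambda>\<omega>. \<Prod>k = 1..m (Z \<omega>). \<integral>y. h k (Z \<omega>) y \<partial>distr M borel (Y k))"
proof -
  have Z [measurable]: "random_variable S Z"
    using indep by (auto simp: indep_elements_def)
  have Y [measurable]: "1 \<le> k \<Longrightarrow> random_variable borel (Y k)" for k
    using Y_indep by (auto simp: indep_vars_def)
  let ?f = "\<lambda>(z, y). \<Prod>k = 1..m z. h k z (y k)"
  have h_seq: "(\<lambda>x. h k (fst x) (snd x k)) \<in> borel_measurable (S \<Otimes>\<^sub>M seq_space)" if "1 \<le> k" for k
  proof -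
    have "(\<lambda>x. (fst x, snd x k)) \<in> measurable (S \<Otimes>\<^sub>M seq_space) (S \<Otimes>\<^sub>M borel)"
      using that by (intro measurable_Pair measurable_fst
          measurable_compose [OF measurable_snd] measurable_component_singleton) auto
    from measurable_compose [OF this h [OF that]] show ?thesis by simp
  qed
  \<comment> \<open>The range of the product depends on the point, so measurability is checked
    separately for each of the countably many values of \<open>m\<close>.\<close>
  have f: "?f \<in> borel_measurable (S \<Otimes>\<^sub>M seq_space)"
    unfolding split_beta'
    by (rule measurable_compose_countable [where g = "\<lambda>x. m (fst x)"])
      (auto intro!: borel_measurable_prod h_seq)
  have "expectation (\<lambda>\<omega>. \<Prod>k = 1..m (Z \<omega>). h k (Z \<omega>) (Y k \<omega>)) =
      expectation (\<lambda>\<omega>. ?f (Z \<omega>, rv_seq Y \<omega>))"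
    by (intro Bochner_Integration.integral_cong) (auto intro!: prod.cong)
  also have "\<dots> = (\<integral>\<omega>. (\<integral>\<omega>'. ?f (Z \<omega>, rv_seq Y \<omega>') \<partial>M) \<partial>M)"
    by (rule indep_elements_integral [OF indep f])
      (auto simp: bound prod_norm [symmetric] intro!: prod_le_1)
  also have "\<dots> = (\<integral>\<omega>. (\<Prod>k = 1..m (Z \<omega>). \<integral>y. h k (Z \<omega>) y \<partial>distr M borel (Y k)) \<partial>M)"
  proof (intro Bochner_Integration.integral_cong refl)
    fix \<omega> assume "\<omega> \<in> space M"
    then have z: "Z \<omega> \<in> space S" by (rule measurable_space [OF Z])
    have hz [measurable]: "h k (Z \<omega>) \<in> borel_measurable borel" if "1 \<le> k" for k
      using measurable_Pair2 [OF h [OF that] z] by simp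
    have "indep_vars (\<lambda>_. borel) (\<lambda>k \<omega>'. h k (Z \<omega>) (Y k \<omega>')) {1..m (Z \<omega>)}"
      by (rule indep_vars_compose2 [OF indep_vars_subset [OF Y_indep]]) auto
    moreover have "integrable M (\<lambda>\<omega>'. h k (Z \<omega>) (Y k \<omega>'))" if "k \<in> {1..m (Z \<omega>)}" for k
      using that by (intro integrable_const_bound [where B = 1]) (auto simp: bound)
    ultimately have "(\<integral>\<omega>'. (\<Prod>k = 1..m (Z \<omega>). h k (Z \<omega>) (Y k \<omega>')) \<partial>M) =
        (\<Prod>k = 1..m (Z \<omega>). \<integral>\<omega>'. h k (Z \<omega>) (Y k \<omega>') \<partial>M)"
      by (intro indep_vars_lebesgue_integral) auto
    also have "\<dots> = (\<Prod>k = 1..m (Z \<omega>). \<integral>y. h k (Z \<omega>) y \<partial>distr M borel (Y k))"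
      by (intro prod.cong refl integral_distr [symmetric]) auto
    finally show "(\<integral>\<omega>'. ?f (Z \<omega>, rv_seq Y \<omega>') \<partial>M) =
        (\<Prod>k = 1..m (Z \<omega>). \<integral>y. h k (Z \<omega>) y \<partial>distr M borel (Y k))"
      by (simp cong: prod.cong_simp)
  qed
  finally show ?thesis .
qed

end

subsection \<open>Riemann sums with right endpoints\<close>

text \<open>The sum is the integral of \<open>w\<close> against a step function whose value at s is
  \<open>f\<close> at the right end of the cell containing s. These ends approach s from the right,
  so right continuity gives pointwise convergence, and domination by \<open>B\<close> times the
  absolute value of \<open>w\<close> does the rest.\<close>

lemma right_riemann_sums_tendsto:
  fixes f :: "real \<Rightarrow> 'b::{banach, second_countable_topology}" and w :: "real \<Rightarrow> real" and t :: real
  assumes t: "0 < t"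
    and w: "set_integrable lborel {0..t} w"
    and f: "\<And>s. 0 \<le> s \<Longrightarrow> s < t \<Longrightarrow> continuous (at_right s) f"
    and bound: "\<And>s. 0 \<le> s \<Longrightarrow> s \<le> t \<Longrightarrow> norm (f s) \<le> B"
  shows "(\<lambda>n. \<Sum>j<n. (LBINT s:{t * j / n<..t * Suc j / n}. w s) *\<^sub>R f (t * Suc j / n))
    \<longlonglongrightarrow> (LBINT s:{0..t}. w s *\<^sub>R f s)"
proof -
  define F where "F n s = (\<Sum>j<n. indicator {t * real j / real n<..t * real (Suc j) / real n} s *\<^sub>R f (t * real (Suc j) / real n))" for n :: nat and s :: real
  have right_end: "t * Suc j / n \<le> t" if "j < n" for j n :: nat
    using mult_left_le [of "Suc j / n" t] t that by (simp add: field_simps)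
  \<comment> \<open>The point r is the right end of the cell of s; it equals s when s is itself a
    grid point, hence the weak inequality.\<close>
  have F: "\<exists>r. s \<le> r \<and> r \<le> t \<and> r \<le> s + t / real n \<and> F n s = f r"
    if s: "0 < s" "s \<le> t" and n: "0 < n" for n :: nat and s :: real
  proof -
    \<comment> \<open>Cells are open on the left and closed on the right, so their index is a
      ceiling minus one; subtraction on \<open>nat\<close> is harmless because s > 0 makes the
      ceiling at least 1.\<close>
    define j where "j = nat \<lceil>n * s / t\<rceil> - 1"
    have pos: "0 < n * s / t" and le: "n * s / t \<le> n" using s n t by (auto simp: field_simps)
    then have c: "1 \<le> \<lceil>n * s / t\<rceil>" "\<lceil>n * s / t\<rceil> \<le> int n" by (auto simp: ceiling_le_iff)
    then have j: "\<lceil>n * s / t\<rceil> = int j + 1" "j < n" unfolding j_def by linarith+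
    have iff: "s \<in> {t * i / n<..t * Suc i / n} \<longleftrightarrow> i = j" for i :: nat
    proof -
      have "s \<in> {t * i / n<..t * Suc i / n} \<longleftrightarrow> real i < n * s / t \<and> n * s / t \<le> real i + 1"
        using t n by (auto simp: field_simps)
      also have "\<dots> \<longleftrightarrow> \<lceil>n * s / t\<rceil> = int i + 1"
        by (auto simp: ceiling_eq_iff)
      finally show ?thesis using j by auto
    qed
    have "F n s = (\<Sum>i<n. if i = j then f (t * Suc i / n) else 0)"
      unfolding F_def using iff by (intro sum.cong refl) (simp add: indicator_def)
    also have "\<dots> = f (t * Suc j / n)"
      using j by simp
    finally have "F n s = f (t * Suc j / n)" .
    moreover have "s \<in> {t * j / n<..t * Suc j / n}" using iff by simp
    moreover have "t * Suc j / n \<le> t"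
      by (rule right_end [OF j(2)])
    ultimately show ?thesis using t
      by (intro exI [of _ "t * Suc j / n"]) (auto simp: distrib_left add_divide_distrib)
  qed
  have F_out: "F n s = 0" if "\<not> (0 < s \<and> s \<le> t)" for n :: nat and s :: real
  proof -
    have "s \<notin> {t * j / n<..t * Suc j / n}" if "j < n" for j
    proof -
      have "0 \<le> t * j / n" "t * Suc j / n \<le> t"
        using t right_end [OF that] by auto
      with \<open>\<not> (0 < s \<and> s \<le> t)\<close> show ?thesis by auto
    qed
    then show ?thesis unfolding F_def by (intro sum.neutral) auto
  qed
  have F_bound: "norm (F n s) \<le> B" if "0 < s" "s \<le> t" for n :: nat and s :: real
  proof (cases "n = 0")
    case True
    then show ?thesis using bound [of 0] t norm_ge_zero [of "f 0"] by (simp add: F_def del: norm_ge_zero)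
  next
    case False
    with F [OF that, of n] obtain r where "s \<le> r" "r \<le> t" "F n s = f r" by auto
    then show ?thesis using bound [of r] that by simp
  qed
  have F_lim: "(\<lambda>n. F n s) \<longlonglongrightarrow> indicator {0<..t} s *\<^sub>R f s" for s :: real
  proof (cases "0 < s \<and> s \<le> t")
    case False
    then show ?thesis by (auto simp: F_out indicator_def)
  next
    case True
    show ?thesis
    proof (rule metric_LIMSEQ_I)
      fix e :: real assume e: "0 < e"
      obtain d where d: "0 < d" "\<And>r. s \<le> r \<Longrightarrow> r \<le> t \<Longrightarrow> dist r s < d \<Longrightarrow> dist (f r) (f s) < e"
      proof (cases "s < t")
        case False
        have "dist (f r) (f s) < e" if "s \<le> r" "r \<le> t" for r
        proof -
          have "r = s" using that False by linarith
          with e show ?thesis by simp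
        qed
        then show ?thesis by (intro that [of 1]) auto
      next
        case st: True
        with f [of s] True e obtain d where d: "0 < d"
          "\<And>r. s < r \<Longrightarrow> dist r s < d \<Longrightarrow> dist (f r) (f s) < e"
          by (auto simp: continuous_within_eps_delta)
        with e show ?thesis
          by (intro that [of d]) (auto simp: le_less)
      qed
      have "(\<lambda>n. t / real n) \<longlonglongrightarrow> 0" by (rule lim_const_over_n)
      from order_tendstoD(2) [OF this d(1)] eventually_gt_at_top [of "0::nat"]
      have "\<forall>\<^sub>F n in sequentially. dist (F n s) (f s) < e"
      proof eventually_elim
        case (elim n)
        with F [of s n] True obtain r where r: "s \<le> r" "r \<le> t" "r \<le> s + t / n" "F n s = f r"
          by auto
        with elim d(2) [of r] show ?case by (auto simp: dist_real_def)
      qed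
      with True show "\<exists>no. \<forall>n\<ge>no. dist (F n s) (indicator {0<..t} s *\<^sub>R f s) < e"
        by (simp add: eventually_sequentially)
    qed
  qed
  have F_meas [measurable]: "F n \<in> borel_measurable borel" for n
    unfolding F_def by measurable
  have w_meas [measurable]: "(\<lambda>s. indicator {0..t} s * w s) \<in> borel_measurable borel"
    using w by (simp add: set_integrable_def integrable_iff_bounded)
  \<comment> \<open>Measurability of \<open>f\<close> on the half-open interval is inherited from
    the step functions.\<close>
  have lim_meas [measurable]: "(\<lambda>s. indicator {0<..t} s *\<^sub>R f s) \<in> borel_measurable borel"
    by (rule borel_measurable_LIMSEQ_metric [OF F_meas F_lim])
  have "(\<lambda>n. \<integral>s. (indicator {0..t} s * w s) *\<^sub>R F n s \<partial>lborel) \<longlonglongrightarrow>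
      (\<integral>s. (indicator {0..t} s * w s) *\<^sub>R (indicator {0<..t} s *\<^sub>R f s) \<partial>lborel)"
  proof (rule integral_dominated_convergence [where w = "\<lambda>s. \<bar>indicator {0..t} s * w s\<bar> * B"])
    show "integrable lborel (\<lambda>s. \<bar>indicator {0..t} s * w s\<bar> * B)"
      using w by (intro integrable_mult_left integrable_abs) (simp add: set_integrable_def)
    show "AE s in lborel. (\<lambda>n. (indicator {0..t} s * w s) *\<^sub>R F n s) \<longlonglongrightarrow>
        (indicator {0..t} s * w s) *\<^sub>R (indicator {0<..t} s *\<^sub>R f s)"
      by (intro AE_I2 tendsto_intros F_lim)
    have "0 \<le> B" using bound [of 0] t norm_ge_zero [of "f 0"] by (simp del: norm_ge_zero)
    then have "norm (F n s) \<le> B" for n :: nat and s :: real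
      using F_bound [of s n] F_out [of s n] by (cases "0 < s \<and> s \<le> t") auto
    then show "AE s in lborel. norm ((indicator {0..t} s * w s) *\<^sub>R F n s) \<le>
        \<bar>indicator {0..t} s * w s\<bar> * B" for n
      by (intro AE_I2) (simp add: mult_left_mono)
  qed measurable
  also have "(\<integral>s. (indicator {0..t} s * w s) *\<^sub>R (indicator {0<..t} s *\<^sub>R f s) \<partial>lborel) =
      (LBINT s:{0..t}. w s *\<^sub>R f s)"
    unfolding set_lebesgue_integral_def
  proof (rule integral_cong_AE)
    show "AE s in lborel. (indicator {0..t} s * w s) *\<^sub>R (indicator {0<..t} s *\<^sub>R f s) =
        indicator {0..t} s *\<^sub>R w s *\<^sub>R f s"
      using AE_lborel_singleton [of 0] by eventually_elim (auto simp: indicator_def)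
    \<comment> \<open>The step functions vanish at 0. Adding the value at this single point back by
      hand recovers the integrand on the closed interval, still measurable.\<close>
    have "(\<lambda>s. (indicator {0..t} s * w s) *\<^sub>R (indicator {0<..t} s *\<^sub>R f s) +
        indicator {0} s *\<^sub>R (w 0 *\<^sub>R f 0)) \<in> borel_measurable borel"
      by measurable
    also have "(\<lambda>s. (indicator {0..t} s * w s) *\<^sub>R (indicator {0<..t} s *\<^sub>R f s) +
        indicator {0} s *\<^sub>R (w 0 *\<^sub>R f 0)) = (\<lambda>s. indicator {0..t} s *\<^sub>R w s *\<^sub>R f s)"
      using t by (auto simp: indicator_def fun_eq_iff)
    finally show "(\<lambda>s. indicator {0..t} s *\<^sub>R w s *\<^sub>R f s) \<in> borel_measurable lborel"
      by simp
  qed measurable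
  finally have lim: "(\<lambda>n. \<integral>s. (indicator {0..t} s * w s) *\<^sub>R F n s \<partial>lborel) \<longlonglongrightarrow>
      (LBINT s:{0..t}. w s *\<^sub>R f s)" .
  have "(\<integral>s. (indicator {0..t} s * w s) *\<^sub>R F n s \<partial>lborel) =
      (\<Sum>j<n. (LBINT s:{t * j / n<..t * Suc j / n}. w s) *\<^sub>R f (t * Suc j / n))" for n
  proof -
    let ?I = "\<lambda>j::nat. {t * j / n<..t * Suc j / n}"
    have sub: "?I j \<subseteq> {0..t}" if "j < n" for j
    proof -
      have "0 \<le> t * j / n" "t * Suc j / n \<le> t"
        using t right_end [OF that] by auto
      then show ?thesis by auto
    qed
    have int: "set_integrable lborel (?I j) w" if "j < n" for j
      by (rule set_integrable_subset [OF w]) (use sub [OF that] in auto)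
    have "(indicator {0..t} s * w s) *\<^sub>R F n s =
        (\<Sum>j<n. (indicator (?I j) s * w s) *\<^sub>R f (t * Suc j / n))" for s
      unfolding F_def scaleR_sum_right
    proof (intro sum.cong refl)
      fix j assume "j \<in> {..<n}"
      with sub [of j] show "(indicator {0..t} s * w s) *\<^sub>R indicator (?I j) s *\<^sub>R f (t * Suc j / n) =
          (indicator (?I j) s * w s) *\<^sub>R f (t * Suc j / n)"
        by (cases "s \<in> ?I j") (auto simp: subset_iff)
    qed
    then show ?thesis
      using int by (simp add: set_lebesgue_integral_def set_integrable_def del: of_nat_Suc)
  qed
  with lim show ?thesis by simp
qed

section \<open>Cell integrals of the power weight, and grouping of products\<close>

lemma set_integrable_powr_diff:
  fixes t \<alpha> :: real
  assumes "0 \<le> \<alpha>"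
  shows "set_integrable lborel {0..t} (\<lambda>s. (t - s) powr \<alpha>)"
  unfolding set_integrable_def
proof (rule Bochner_Integration.integrable_bound)
  show "integrable lborel (\<lambda>s. indicator {0..t} s *\<^sub>R t powr \<alpha>)"
    by (cases "0 \<le> t") auto
  show "AE s in lborel. norm (indicator {0..t} s *\<^sub>R (t - s) powr \<alpha>)
      \<le> norm (indicator {0..t} s *\<^sub>R t powr \<alpha>)"
    using assms by (auto simp: indicator_def intro!: powr_mono2)
qed measurable

text \<open>The antiderivative is differentiated in the open interval only: for b = t the base t - s
  vanishes at the right end, where merely continuity is used.\<close>

lemma set_lebesgue_integral_powr_diff:
  fixes a b t \<alpha> :: real
  assumes "0 \<le> \<alpha>" "0 \<le> a" "a \<le> b" "b \<le> t"
  shows "(LBINT s:{a<..b}. (t - s) powr \<alpha>) =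
    (t - a) powr (\<alpha> + 1) / (\<alpha> + 1) - (t - b) powr (\<alpha> + 1) / (\<alpha> + 1)"
proof -
  let ?G = "\<lambda>s. - ((t - s) powr (\<alpha> + 1) / (\<alpha> + 1))"
  have "((\<lambda>s. (t - s) powr \<alpha>) has_integral (?G b - ?G a)) {a..b}"
  proof (rule fundamental_theorem_of_calculus_interior)
    show "continuous_on {a..b} ?G"
      using assms by (intro continuous_intros continuous_on_powr') auto
    fix s assume "s \<in> {a<..<b}"
    then have "0 < t - s" using assms by simp
    moreover have "((\<lambda>s. t - s) has_real_derivative - 1) (at s)"
      by (auto intro!: derivative_eq_intros)
    ultimately have "((\<lambda>s. (t - s) powr (\<alpha> + 1)) has_real_derivative
        (\<alpha> + 1) * (t - s) powr (\<alpha> + 1 - 1) * - 1) (at s)"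
      by (rule DERIV_chain2 [OF has_real_derivative_powr])
    from DERIV_minus [OF DERIV_cdivide [OF this, of "\<alpha> + 1"]]
    have "(?G has_real_derivative (t - s) powr \<alpha>) (at s)"
      using assms by simp
    then show "(?G has_vector_derivative (t - s) powr \<alpha>) (at s)"
      by (rule has_real_derivative_iff_has_vector_derivative [THEN iffD1])
  qed fact
  then have "integral {a..b} (\<lambda>s. (t - s) powr \<alpha>) = ?G b - ?G a"
    by (rule integral_unique)
  moreover have "set_integrable lborel {a..b} (\<lambda>s. (t - s) powr \<alpha>)"
    by (rule set_integrable_subset [OF set_integrable_powr_diff]) (use assms in auto)
  moreover have "(LBINT s:{a<..b}. (t - s) powr \<alpha>) = (LBINT s:{a..b}. (t - s) powr \<alpha>)"
    using interval_integral_Ioc [OF \<open>a \<le> b\<close>] interval_integral_Icc [OF \<open>a \<le> b\<close>] by metis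
  ultimately show ?thesis
    by (simp add: set_borel_integral_eq_integral)
qed

text \<open>Meant for \<open>z j\<close> the number of jumps up to the j-th grid time: the blocks
  are then the index sets of the jumps in the successive grid cells.\<close>

lemma prod_blocks:
  fixes z :: "nat \<Rightarrow> nat" and f :: "nat \<Rightarrow> 'a::comm_monoid_mult"
  assumes "z 0 = 0" "\<And>j. j < m \<Longrightarrow> z j \<le> z (Suc j)"
  shows "(\<Prod>k = 1..z m. f k) = (\<Prod>j<m. \<Prod>k\<in>{z j<..z (Suc j)}. f k)"
  using assms(2)
proof (induction m)
  case 0
  then show ?case using assms(1) by simp
next
  case (Suc m)
  then have "z m \<le> z (Suc m)" by simp
  then have "{1..z (Suc m)} = {1..z m} \<union> {z m<..z (Suc m)}" by auto
  then have "(\<Prod>k = 1..z (Suc m). f k) = (\<Prod>k = 1..z m. f k) * (\<Prod>k\<in>{z m<..z (Suc m)}. f k)"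
    by (simp only:) (rule prod.union_disjoint; auto)
  with Suc show ?case by simp
qed

text \<open>The domain is a null set or empty. The case t = 0 is the degenerate instance of the
  identity in law; t < 0 is covered because the convergence criteria ask for measurability at every
  real t.\<close>

lemma set_integral_Icc_nonpos:
  fixes f :: "real \<Rightarrow> real"
  assumes "t \<le> 0"
  shows "(LBINT s:{0..t}. f s) = 0"
  unfolding set_lebesgue_integral_def
  by (rule integral_eq_zero_AE, use AE_lborel_singleton [of "0::real"] in eventually_elim)
    (use assms in \<open>auto simp: indicator_def\<close>)

lemma integral_uniform_unit_interval:
  fixes f :: "real \<Rightarrow> 'b::{banach, second_countable_topology}"
  assumes [measurable]: "f \<in> borel_measurable borel"
  shows "(\<integral>v. f v \<partial>uniform_measure lborel {0<..<1}) = (LBINT v:{0..1}. f v)"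
proof -
  have "uniform_measure lborel {0<..<1::real} = density lborel (\<lambda>v. ennreal (indicator {0<..<1} v))"
    by (simp add: uniform_measure_def ennreal_indicator divide_ennreal_def)
  then have "(\<integral>v. f v \<partial>uniform_measure lborel {0<..<1}) = (\<integral>v. indicator {0<..<1} v *\<^sub>R f v \<partial>lborel)"
    by (simp add: integral_density)
  also have "\<dots> = (LBINT v:{0..1}. f v)"
    unfolding set_lebesgue_integral_def
  proof (rule integral_cong_AE)
    show "AE v in lborel. indicator {0<..<1} v *\<^sub>R f v = indicator {0..1} v *\<^sub>R f v"
      using AE_lborel_singleton [of 0] AE_lborel_singleton [of 1]
      by eventually_elim (auto simp: indicator_def)
  qed measurable
  finally show ?thesis .
qed

subsection \<open>Criteria by characteristic functions\<close>

text \<open>The Taylor error at y / sqrt r is at most (y^2 / r) / 6 times the expectation of min (6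
  x^2) (|y / sqrt r| |x|^3). The factor r cancels, and dominated convergence with majorant 6 x^2
  sends the expectation to 0 using second moments only. The second claim is the bound that later
  allows the limit to be taken under an integral over y.\<close>

lemma (in real_distribution) char_second_order_tendsto:
  assumes int: "integrable M (\<lambda>x. x\<^sup>2)" and mean: "expectation (\<lambda>x. x) = 0"
  shows "((\<lambda>r. of_real r * (char M (y / sqrt r) - 1)) \<longlongrightarrow> - of_real (y\<^sup>2 * expectation (\<lambda>x. x\<^sup>2) / 2)) at_top"
    and "0 < r \<Longrightarrow> norm (of_real r * (char M (y / sqrt r) - 1)) \<le> 2 * y\<^sup>2 * expectation (\<lambda>x. x\<^sup>2)"
proof -
  let ?\<sigma>2 = "expectation (\<lambda>x. x\<^sup>2)"
  let ?E = "\<lambda>r. expectation (\<lambda>x. min (6 * x\<^sup>2) (\<bar>y / sqrt r\<bar> * \<bar>x\<bar> ^ 3))"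
  have int1: "integrable M (\<lambda>x. x)"
    by (rule square_integrable_imp_integrable [OF _ int]) simp
  have approx: "norm (of_real r * (char M (y / sqrt r) - 1) + of_real (y\<^sup>2 * ?\<sigma>2 / 2)) \<le> y\<^sup>2 / 6 * ?E r"
    if r: "0 < r" for r
  proof -
    have "y\<^sup>2 * ?\<sigma>2 / 2 = r * ((y / sqrt r)\<^sup>2 * ?\<sigma>2 / 2)"
      using r by (simp add: power_divide)
    then have "of_real r * (char M (y / sqrt r) - 1) + of_real (y\<^sup>2 * ?\<sigma>2 / 2) =
        of_real r * (char M (y / sqrt r) - (1 - of_real ((y / sqrt r)\<^sup>2 * ?\<sigma>2 / 2)))"
      by (simp only: of_real_mult [of r]) (simp add: algebra_simps)
    also have "norm \<dots> = r * norm (char M (y / sqrt r) - (1 - (y / sqrt r)\<^sup>2 * ?\<sigma>2 / 2))"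
      using r by (simp add: norm_mult)
    also have "\<dots> \<le> r * ((y / sqrt r)\<^sup>2 / 6 * ?E r)"
      using r by (intro mult_left_mono char_approx3 int1 int mean) (simp_all add: mean)
    also have "\<dots> = y\<^sup>2 / 6 * ?E r"
      using r by (simp add: power_divide)
    finally show ?thesis .
  qed
  have int6: "integrable M (\<lambda>x. 6 * x\<^sup>2)" using int by simp
  have "(?E \<longlongrightarrow> expectation (\<lambda>x. 0)) at_top"
  proof (rule integral_dominated_convergence_at_top [OF _ _ int6])
    show "\<forall>\<^sub>F r in at_top. AE x in M. norm (min (6 * x\<^sup>2) (\<bar>y / sqrt r\<bar> * \<bar>x\<bar> ^ 3)) \<le> 6 * x\<^sup>2"
      by (intro always_eventually allI AE_I2) (auto simp: min_def)
    show "AE x in M. ((\<lambda>r. min (6 * x\<^sup>2) (\<bar>y / sqrt r\<bar> * \<bar>x\<bar> ^ 3)) \<longlongrightarrow> 0) at_top"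
    proof (rule AE_I2)
      fix x
      have "((\<lambda>r. \<bar>y / sqrt r\<bar> * \<bar>x\<bar> ^ 3) \<longlongrightarrow> \<bar>0\<bar> * \<bar>x\<bar> ^ 3) at_top"
        by (intro tendsto_mult tendsto_rabs tendsto_const tendsto_divide_0 [OF tendsto_const]
            filterlim_at_top_imp_at_infinity sqrt_at_top)
      then have "((\<lambda>r. min (6 * x\<^sup>2) (\<bar>y / sqrt r\<bar> * \<bar>x\<bar> ^ 3)) \<longlongrightarrow> min (6 * x\<^sup>2) (\<bar>0\<bar> * \<bar>x\<bar> ^ 3)) at_top"
        by (intro tendsto_min tendsto_const)
      then show "((\<lambda>r. min (6 * x\<^sup>2) (\<bar>y / sqrt r\<bar> * \<bar>x\<bar> ^ 3)) \<longlongrightarrow> 0) at_top"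
        by simp
    qed
  qed measurable
  then have lim: "((\<lambda>r. y\<^sup>2 / 6 * ?E r) \<longlongrightarrow> 0) at_top"
    by (simp only: Bochner_Integration.integral_zero tendsto_mult_right_zero)
  have "((\<lambda>r. of_real r * (char M (y / sqrt r) - 1) + of_real (y\<^sup>2 * ?\<sigma>2 / 2)) \<longlongrightarrow> 0) at_top"
    by (rule Lim_null_comparison [OF _ lim]) (rule eventually_mono [OF eventually_gt_at_top [of 0] approx])
  then show "((\<lambda>r. of_real r * (char M (y / sqrt r) - 1)) \<longlongrightarrow> - of_real (y\<^sup>2 * ?\<sigma>2 / 2)) at_top"
    using tendsto_diff [OF _ tendsto_const [of "of_real (y\<^sup>2 * ?\<sigma>2 / 2)"]] by fastforce
  assume r: "0 < r"
  \<comment> \<open>Bounding the minimum by 6 x^2 makes the error at most y^2 times the second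
    moment; the main term contributes half as much, and 3/2 is rounded up to 2.\<close>
  have "?E r \<le> expectation (\<lambda>x. 6 * x\<^sup>2)"
    by (intro integral_mono int6 Bochner_Integration.integrable_bound [OF int6]) (auto simp: min_def)
  then have "y\<^sup>2 / 6 * ?E r \<le> y\<^sup>2 / 6 * (6 * ?\<sigma>2)"
    by (intro mult_left_mono) auto
  with approx [OF r]
  have "norm (of_real r * (char M (y / sqrt r) - 1) + of_real (y\<^sup>2 * ?\<sigma>2 / 2)) \<le> y\<^sup>2 * ?\<sigma>2"
    by simp
  moreover have "norm (complex_of_real (y\<^sup>2 * ?\<sigma>2 / 2)) = y\<^sup>2 * ?\<sigma>2 / 2"
    unfolding norm_of_real by simp
  moreover have "norm (of_real r * (char M (y / sqrt r) - 1)) \<le>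
      norm (of_real r * (char M (y / sqrt r) - 1) + of_real (y\<^sup>2 * ?\<sigma>2 / 2)) +
      norm (complex_of_real (y\<^sup>2 * ?\<sigma>2 / 2))"
    by (metis norm_triangle_ineq4 add_diff_cancel_right')
  moreover have "0 \<le> y\<^sup>2 * ?\<sigma>2" by simp
  ultimately show "norm (of_real r * (char M (y / sqrt r) - 1)) \<le> 2 * y\<^sup>2 * ?\<sigma>2"
    by linarith
qed

lemma (in prob_space) eq_in_distributionI_char:
  assumes [measurable]: "random_variable borel Y" "random_variable borel Z"
    and char: "\<And>u. expectation (\<lambda>\<omega>. iexp (u * Y \<omega>)) = expectation (\<lambda>\<omega>. iexp (u * Z \<omega>))"
  shows "eq_in_distribution M Y M Z"
proof -
  have "char (distr M borel Y) u = char (distr M borel Z) u" for u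
    using char [of u] by (simp add: char_def integral_distr)
  then have "distr M borel Y = distr M borel Z"
    by (intro Levy_uniqueness real_distribution_distr ext) auto
  then show ?thesis by (simp add: eq_in_distribution_def)
qed

text \<open>Levy's theorem speaks of sequences, so the limit along real t is tested along arbitrary
  sequences tending to infinity.\<close>

lemma (in prob_space) tendsto_in_distributionI_char:
  fixes Y :: "real \<Rightarrow> 'a \<Rightarrow> real"
  assumes Y: "\<And>t. random_variable borel (Y t)"
    and \<mu>: "real_distribution \<mu>"
    and lim: "\<And>u. ((\<lambda>t. expectation (\<lambda>\<omega>. iexp (u * Y t \<omega>))) \<longlongrightarrow> char \<mu> u) at_top"
  shows "tendsto_in_distribution M Y \<mu> at_top"
  unfolding tendsto_in_distribution_def
proof (intro conjI allI impI always_eventually Y tendsto_at_topI_sequentially)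
  fix x and T :: "nat \<Rightarrow> real"
  assume x: "isCont (cdf \<mu>) x" and T: "filterlim T at_top sequentially"
  have "weak_conv_m (\<lambda>n. distr M borel (Y (T n))) \<mu>"
  proof (rule levy_continuity)
    fix u
    have "char (distr M borel (Y t)) u = expectation (\<lambda>\<omega>. iexp (u * Y t \<omega>))" for t
      using Y by (simp add: char_def integral_distr)
    with filterlim_compose [OF lim T, of u]
    show "(\<lambda>n. char (distr M borel (Y (T n))) u) \<longlonglongrightarrow> char \<mu> u" by simp
  qed (auto intro: real_distribution_distr Y \<mu>)
  with x show "(\<lambda>n. cdf (distr M borel (Y (T n))) x) \<longlonglongrightarrow> cdf \<mu> x"
    by (simp add: weak_conv_m_def weak_conv_def)
qed

text \<open>Both \<epsilon> and -\<epsilon> are continuity points of the distribution function of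
  the point mass at 0, and the two tails are bounded by 1 - F(\<epsilon>) and
  F(-\<epsilon>).\<close>

lemma (in prob_space) tendsto_in_probability_zeroI:
  fixes Y :: "'i \<Rightarrow> 'a \<Rightarrow> real"
  assumes Y: "\<And>i. random_variable borel (Y i)"
    and lim: "tendsto_in_distribution M Y (return borel 0) F"
  shows "tendsto_in_probability M Y (\<lambda>_. 0) F"
  unfolding tendsto_in_probability_def
proof (intro conjI allI impI always_eventually Y)
  fix \<epsilon> :: real assume \<epsilon>: "0 < \<epsilon>"
  interpret R: real_distribution "return borel (0::real)"
    by (simp add: real_distribution_def real_distribution_axioms_def prob_space_return)
  have cdf_lim: "((\<lambda>i. cdf (distr M borel (Y i)) x) \<longlongrightarrow> (if 0 \<le> x then 1 else 0)) F" if "x \<noteq> 0" for x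
  proof -
    have "isCont (cdf (return borel 0)) x"
      using that by (simp add: R.isCont_cdf measure_return)
    with lim have "((\<lambda>i. cdf (distr M borel (Y i)) x) \<longlongrightarrow> cdf (return borel 0) x) F"
      by (simp add: tendsto_in_distribution_def)
    then show ?thesis by (cases "0 \<le> x") (simp_all add: cdf_def measure_return)
  qed
  have "((\<lambda>i. (1 - cdf (distr M borel (Y i)) \<epsilon>) + cdf (distr M borel (Y i)) (- \<epsilon>)) \<longlongrightarrow> (1 - 1) + 0) F"
    using cdf_lim [of \<epsilon>] cdf_lim [of "- \<epsilon>"] \<epsilon> by (intro tendsto_add tendsto_diff tendsto_const) auto
  then have lim0: "((\<lambda>i. (1 - cdf (distr M borel (Y i)) \<epsilon>) + cdf (distr M borel (Y i)) (- \<epsilon>)) \<longlongrightarrow> 0) F"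
    by simp
  have "prob {\<omega> \<in> space M. \<epsilon> < \<bar>Y i \<omega> - 0\<bar>} \<le>
      (1 - cdf (distr M borel (Y i)) \<epsilon>) + cdf (distr M borel (Y i)) (- \<epsilon>)" for i
  proof -
    have [measurable]: "random_variable borel (Y i)" by (rule Y)
    have cdf: "cdf (distr M borel (Y i)) x = prob {\<omega> \<in> space M. Y i \<omega> \<le> x}" for x
      by (auto simp: cdf_def measure_distr intro!: arg_cong [where f = prob])
    have "prob {\<omega> \<in> space M. \<epsilon> < \<bar>Y i \<omega> - 0\<bar>} \<le>
        prob ({\<omega> \<in> space M. \<not> Y i \<omega> \<le> \<epsilon>} \<union> {\<omega> \<in> space M. Y i \<omega> \<le> - \<epsilon>})"
      by (intro finite_measure_mono) auto
    also have "\<dots> \<le> prob {\<omega> \<in> space M. \<not> Y i \<omega> \<le> \<epsilon>} + prob {\<omega> \<in> space M. Y i \<omega> \<le> - \<epsilon>}"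
      by (intro measure_Un_le) auto
    also have "\<dots> = (1 - cdf (distr M borel (Y i)) \<epsilon>) + cdf (distr M borel (Y i)) (- \<epsilon>)"
      by (subst prob_neg) (auto simp: cdf)
    finally show ?thesis .
  qed
  then show "((\<lambda>i. prob {\<omega> \<in> space M. \<epsilon> < \<bar>Y i \<omega> - 0\<bar>}) \<longlongrightarrow> 0) F"
    by (intro tendsto_sandwich [OF _ _ tendsto_const lim0] always_eventually) auto
qed simp

text \<open>The formula includes v = 0, which occurs in the second limit when the jumps vanish
  almost surely and also provides the point mass for the first limit.\<close>

lemma normal_law_char:
  assumes "0 \<le> v"
  shows "real_distribution (normal_law 0 v)" "char (normal_law 0 v) u = of_real (exp (- (v * u\<^sup>2) / 2))"
proof -
  have "real_distribution (normal_law 0 v) \<and> char (normal_law 0 v) u = of_real (exp (- (v * u\<^sup>2) / 2))"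
  proof (cases "v = 0")
    case True
    have "char (return borel 0) u = 1"
      by (simp add: char_def integral_return)
    with True show ?thesis
      by (simp add: normal_law_def real_distribution_def real_distribution_axioms_def prob_space_return)
  next
    case False
    with assms have v: "0 < v" by simp
    interpret std: real_distribution std_normal_distribution by (rule real_dist_normal_dist)
    have "distributed std_normal_distribution lborel (\<lambda>x. x) std_normal_density"
      by (simp add: distributed_def distr_id2)
    from std.normal_density_affine [OF this, of "sqrt v" 0] v
    have "distr std_normal_distribution lborel (\<lambda>x. sqrt v * x) = density lborel (normal_density 0 (sqrt v))"
      by (simp add: distributed_def)
    then have eq: "normal_law 0 v = distr std_normal_distribution borel (\<lambda>x. sqrt v * x)"
      using False by (simp add: normal_law_def cong: distr_cong)
    have "char (normal_law 0 v) u = char std_normal_distribution (u * sqrt v)"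
      unfolding eq char_def by (subst integral_distr) (simp_all add: mult.assoc)
    also have "\<dots> = of_real (exp (- (v * u\<^sup>2) / 2))"
      using v by (simp add: char_std_normal_distribution power_mult_distrib mult.commute)
    finally show ?thesis
      unfolding eq by (auto intro: std.real_distribution_distr)
  qed
  then show "real_distribution (normal_law 0 v)" "char (normal_law 0 v) u = of_real (exp (- (v * u\<^sup>2) / 2))"
    by auto
qed

subsection \<open>Compound Poisson processes\<close>

context compound_poisson
begin

abbreviation jump_char :: "real \<Rightarrow> complex" where
  "jump_char \<equiv> char (distr Q borel X)"

lemma real_distribution_jump: "real_distribution (distr Q borel X)"
  using jump_measurable by (rule jump.real_distribution_distr)

lemma jumps_measurable: "1 \<le> k \<Longrightarrow> random_variable borel (Xs k)"
  using jumps_indep by (auto simp: indep_vars_def)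

lemma count_mono: "\<omega> \<in> space P \<Longrightarrow> 0 \<le> s \<Longrightarrow> s \<le> t \<Longrightarrow> N s \<omega> \<le> N t \<omega>"
  using path_mono [of \<omega>] by (auto simp: mono_on_def)

lemma compound_sum_measurable:
  assumes "0 \<le> t"
  shows "random_variable borel (compound_sum N Xs t)"
  unfolding compound_sum_def [abs_def]
  by (rule measurable_compose_countable [OF _ count_measurable [OF assms]])
    (auto intro!: borel_measurable_sum jumps_measurable)

section \<open>Linear combinations of finitely many values of the process\<close>

lemma increment_pgf:
  fixes z :: complex
  assumes "0 \<le> s" "s < t"
  shows "expectation (\<lambda>\<omega>. z ^ (N t \<omega> - N s \<omega>)) = exp (rate * (t - s) * (z - 1))"
proof -
  have [measurable]: "random_variable (count_space UNIV) (N t)" "random_variable (count_space UNIV) (N s)"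
    using assms by (auto intro: count_measurable)
  have "expectation (\<lambda>\<omega>. z ^ (N t \<omega> - N s \<omega>)) =
      (\<integral>n. z ^ n \<partial>distr P (count_space UNIV) (\<lambda>\<omega>. N t \<omega> - N s \<omega>))"
    by (rule integral_distr [symmetric]) auto
  also have "\<dots> = exp (of_real (rate * (t - s)) * (z - 1))"
    using assms rate_pos by (subst increments_poisson) (auto simp: poisson_pmf_pgf)
  finally show ?thesis by simp
qed

text \<open>Summing by jumps instead of by times makes each jump carry a weight determined by the
  path. Averaging the jumps with the path frozen gives one factor of \<open>jump_char\<close> per
  jump; jumps in the same cell share their weight, so each cell contributes a power with a Poisson
  increment as exponent, and these increments are independent.\<close>

lemma weighted_sum_char:
  fixes c :: "nat \<Rightarrow> real" and \<tau> :: "nat \<Rightarrow> real"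
  assumes \<tau>0: "\<tau> 0 = 0" and \<tau>: "\<And>j. j < n \<Longrightarrow> \<tau> j < \<tau> (Suc j)"
  shows "expectation (\<lambda>\<omega>. iexp (u * (\<Sum>j<n. c j * compound_sum N Xs (\<tau> (Suc j)) \<omega>))) =
    exp (rate * (\<Sum>j<n. (\<tau> (Suc j) - \<tau> j) * (jump_char (u * (\<Sum>i=j..<n. c i)) - 1)))"
proof -
  have \<tau>_mono: "\<tau> i \<le> \<tau> j" if "i \<le> j" "j \<le> n" for i j
    using that by (induction rule: dec_induct) (simp, metis Suc_leD Suc_le_lessD \<tau> less_imp_le order_trans)
  have \<tau>_nonneg: "0 \<le> \<tau> j" if "j \<le> n" for j
    using \<tau>_mono [of 0 j] that \<tau>0 by simp
  \<comment> \<open>The total weight of the \<open>k\<close>-th jump; it is \<open>\<Sum>i=j..<n. c i\<close> if the jump falls between \<open>\<tau> j\<close> and \<open>\<tau> (Suc j)\<close>.\<close>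
  define a where "a z k = (\<Sum>i<n. c i * of_bool (k \<le> z (\<tau> (Suc i))))"
    for z :: "real \<Rightarrow> nat" and k :: nat
  have a_path: "a (count_path N \<omega>) k = (\<Sum>i<n. c i * of_bool (k \<le> N (\<tau> (Suc i)) \<omega>))" for \<omega> k
    unfolding a_def using \<tau>_nonneg by (intro sum.cong refl) auto
  \<comment> \<open>All inner sums are extended to the jumps up to the last grid time, with an
    indicator for those already counted, so that the order of summation can be exchanged.\<close>
  have rewrite: "(\<Sum>j<n. c j * compound_sum N Xs (\<tau> (Suc j)) \<omega>) =
      (\<Sum>k = 1..count_path N \<omega> (\<tau> n). a (count_path N \<omega>) k * Xs k \<omega>)" if "\<omega> \<in> space P" for \<omega>
  proof -
    have "compound_sum N Xs (\<tau> (Suc j)) \<omega> =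
        (\<Sum>k = 1..N (\<tau> n) \<omega>. of_bool (k \<le> N (\<tau> (Suc j)) \<omega>) * Xs k \<omega>)" if "j < n" for j
      unfolding compound_sum_def
      using count_mono [OF \<open>\<omega> \<in> space P\<close> \<tau>_nonneg \<tau>_mono, of "Suc j" n] that
      by (intro sum.mono_neutral_cong_left) auto
    then have "(\<Sum>j<n. c j * compound_sum N Xs (\<tau> (Suc j)) \<omega>) =
        (\<Sum>j<n. \<Sum>k = 1..N (\<tau> n) \<omega>. c j * of_bool (k \<le> N (\<tau> (Suc j)) \<omega>) * Xs k \<omega>)"
      by (intro sum.cong refl) (simp only: lessThan_iff sum_distrib_left mult.assoc)
    also have "\<dots> = (\<Sum>k = 1..N (\<tau> n) \<omega>. a (count_path N \<omega>) k * Xs k \<omega>)"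
      unfolding a_path sum_distrib_right by (rule sum.swap)
    finally show ?thesis using \<tau>_nonneg [of n] by simp
  qed
  have coord: "(\<lambda>z. z (\<tau> i)) \<in> measurable path_space (count_space UNIV)" if "i \<le> n" for i
    using \<tau>_nonneg [OF that] by (intro measurable_component_singleton) auto
  have a_meas: "(\<lambda>z. a z k) \<in> borel_measurable path_space" for k
    unfolding a_def
  proof (intro borel_measurable_sum borel_measurable_times borel_measurable_const)
    fix i assume "i \<in> {..<n}"
    then have "(\<lambda>z. z (\<tau> (Suc i))) \<in> measurable path_space (count_space UNIV)"
      by (intro coord) auto
    from measurable_compose [OF this, of "\<lambda>m. of_bool (k \<le> m)" borel]
    show "(\<lambda>z. of_bool (k \<le> z (\<tau> (Suc i))) :: real) \<in> borel_measurable path_space"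
      by simp
  qed
  have blocks: "(\<Prod>k = 1..count_path N \<omega> (\<tau> n). jump_char (u * a (count_path N \<omega>) k)) =
      (\<Prod>j<n. jump_char (u * (\<Sum>i=j..<n. c i)) ^ (N (\<tau> (Suc j)) \<omega> - N (\<tau> j) \<omega>))"
    if \<omega>: "\<omega> \<in> space P" for \<omega>
  proof -
    have "(\<Prod>k = 1..N (\<tau> n) \<omega>. jump_char (u * a (count_path N \<omega>) k)) =
        (\<Prod>j<n. \<Prod>k\<in>{N (\<tau> j) \<omega><..N (\<tau> (Suc j)) \<omega>}. jump_char (u * a (count_path N \<omega>) k))"
      using \<tau>0 \<omega> start_zero \<tau>_nonneg \<tau>_mono
      by (intro prod_blocks [of "\<lambda>j. N (\<tau> j) \<omega>"]) (auto intro!: count_mono)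
    also have "\<dots> = (\<Prod>j<n. \<Prod>k\<in>{N (\<tau> j) \<omega><..N (\<tau> (Suc j)) \<omega>}. jump_char (u * (\<Sum>i=j..<n. c i)))"
    proof (intro prod.cong refl)
      fix j k assume j: "j \<in> {..<n}" and k: "k \<in> {N (\<tau> j) \<omega><..N (\<tau> (Suc j)) \<omega>}"
      \<comment> \<open>A jump in cell j is counted at the end of cell i exactly when i is not
        before j; hence its weight is the tail sum of \<open>c\<close> from j.\<close>
      have "k \<le> N (\<tau> (Suc i)) \<omega> \<longleftrightarrow> j \<le> i" if "i < n" for i
      proof (cases "j \<le> i")
        case True
        then show ?thesis
          using count_mono [OF \<omega> \<tau>_nonneg \<tau>_mono, of "Suc j" "Suc i"] j k that by auto
      next
        case False
        then show ?thesis
          using count_mono [OF \<omega> \<tau>_nonneg \<tau>_mono, of "Suc i" j] j k that by auto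
      qed
      then have "a (count_path N \<omega>) k = (\<Sum>i=j..<n. c i)"
        unfolding a_path by (intro sum.mono_neutral_cong_right) auto
      then show "jump_char (u * a (count_path N \<omega>) k) = jump_char (u * (\<Sum>i=j..<n. c i))"
        by simp
    qed
    finally show ?thesis using \<tau>_nonneg [of n] by simp
  qed
  have "expectation (\<lambda>\<omega>. iexp (u * (\<Sum>j<n. c j * compound_sum N Xs (\<tau> (Suc j)) \<omega>))) =
      expectation (\<lambda>\<omega>. \<Prod>k = 1..count_path N \<omega> (\<tau> n). iexp (u * a (count_path N \<omega>) k * Xs k \<omega>))"
    by (intro Bochner_Integration.integral_cong refl)
      (simp add: rewrite sum_distrib_left exp_sum [symmetric] mult.assoc cong: sum.cong_simp)
  also have "\<dots> = expectation (\<lambda>\<omega>. \<Prod>k = 1..count_path N \<omega> (\<tau> n).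
      \<integral>x. iexp (u * a (count_path N \<omega>) k * x) \<partial>distr P borel (Xs k))"
  proof (rule indep_elements_random_prod [where Z = "count_path N" and m = "\<lambda>z. z (\<tau> n)"
        and h = "\<lambda>k z x. iexp (u * a z k * x)", OF jumps_indep_count jumps_indep coord [of n]])
    fix k :: nat
    have [measurable]: "(\<lambda>p. a (fst p) k) \<in> borel_measurable (path_space \<Otimes>\<^sub>M borel)"
      by (rule measurable_compose [OF measurable_fst a_meas])
    show "(\<lambda>(z, x). iexp (u * a z k * x)) \<in> borel_measurable (path_space \<Otimes>\<^sub>M borel)"
      unfolding split_beta' by measurable
  qed auto
  also have "\<dots> = expectation (\<lambda>\<omega>. \<Prod>k = 1..count_path N \<omega> (\<tau> n). jump_char (u * a (count_path N \<omega>) k))"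
    by (intro Bochner_Integration.integral_cong prod.cong refl) (auto simp: char_def jumps_distr)
  also have "\<dots> = expectation (\<lambda>\<omega>. \<Prod>j<n.
      jump_char (u * (\<Sum>i=j..<n. c i)) ^ (N (\<tau> (Suc j)) \<omega> - N (\<tau> j) \<omega>))"
    by (intro Bochner_Integration.integral_cong refl blocks)
  also have "\<dots> = (\<Prod>j<n. expectation (\<lambda>\<omega>.
      jump_char (u * (\<Sum>i=j..<n. c i)) ^ (N (\<tau> (Suc j)) \<omega> - N (\<tau> j) \<omega>)))"
  proof (rule indep_vars_lebesgue_integral)
    have "indep_vars (\<lambda>_. count_space UNIV) (\<lambda>j \<omega>. N (\<tau> (Suc j)) \<omega> - N (\<tau> j) \<omega>) {..<n}"
      using \<tau>0 \<tau> by (intro increments_indep) (auto intro: less_imp_le)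
    then show "indep_vars (\<lambda>_. borel) (\<lambda>j \<omega>. jump_char (u * (\<Sum>i=j..<n. c i)) ^
        (N (\<tau> (Suc j)) \<omega> - N (\<tau> j) \<omega>)) {..<n}"
      by (rule indep_vars_compose2) auto
    fix j assume "j \<in> {..<n}"
    then have [measurable]: "random_variable (count_space UNIV) (N (\<tau> (Suc j)))"
      "random_variable (count_space UNIV) (N (\<tau> j))"
      using \<tau>_nonneg by (auto intro!: count_measurable)
    show "integrable P (\<lambda>\<omega>. jump_char (u * (\<Sum>i=j..<n. c i)) ^ (N (\<tau> (Suc j)) \<omega> - N (\<tau> j) \<omega>))"
      by (rule integrable_const_bound [where B = 1])
        (auto simp: norm_power power_le_one real_distribution.cmod_char_le_1 [OF real_distribution_jump])
  qed simp
  also have "\<dots> = (\<Prod>j<n. exp (rate * (\<tau> (Suc j) - \<tau> j) * (jump_char (u * (\<Sum>i=j..<n. c i)) - 1)))"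
    using \<tau> \<tau>_nonneg by (intro prod.cong refl increment_pgf) auto
  also have "\<dots> = exp (rate * (\<Sum>j<n. (\<tau> (Suc j) - \<tau> j) * (jump_char (u * (\<Sum>i=j..<n. c i)) - 1)))"
    by (simp add: exp_sum [symmetric] sum_distrib_left mult.assoc)
  finally show ?thesis .
qed

section \<open>The characteristic function of the weighted integral\<close>

text \<open>The characteristic function of X V^a, with V uniform and independent of X, after X has
  been integrated out. This order of integration leaves a one-dimensional integral that grid sums
  approximate directly.\<close>

definition mixed_char :: "real \<Rightarrow> real \<Rightarrow> complex" where
  "mixed_char a u = (LBINT v:{0..1}. jump_char (u * v powr a))"

text \<open>A right-continuous path with values in \<open>nat\<close> is constant just to the right
  of each time, and so is any function of its value.\<close>

lemma compound_sum_right_continuous: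
  assumes "\<omega> \<in> space P" "0 \<le> s"
  shows "continuous (at_right s) (\<lambda>r. compound_sum N Xs r \<omega>)"
proof -
  have "\<forall>\<^sub>F r in at_right s. N r \<omega> = N s \<omega>"
    using path_right_continuous [OF assms] by (simp add: continuous_within tendsto_discrete)
  then show ?thesis
    unfolding continuous_within compound_sum_def
    by (intro tendsto_eventually) (auto elim: eventually_mono)
qed

lemma compound_sum_bounded:
  fixes t :: real
  assumes "\<omega> \<in> space P"
  obtains B where "\<And>s. 0 \<le> s \<Longrightarrow> s \<le> t \<Longrightarrow> \<bar>compound_sum N Xs s \<omega>\<bar> \<le> B"
proof
  fix s assume "0 \<le> s" "s \<le> t"
  have "\<bar>compound_sum N Xs s \<omega>\<bar> \<le> (\<Sum>k = 1..N s \<omega>. \<bar>Xs k \<omega>\<bar>)"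
    unfolding compound_sum_def by (rule sum_abs)
  also have "\<dots> \<le> (\<Sum>k = 1..N t \<omega>. \<bar>Xs k \<omega>\<bar>)"
    using count_mono [OF assms \<open>0 \<le> s\<close> \<open>s \<le> t\<close>] by (intro sum_mono2) auto
  finally show "\<bar>compound_sum N Xs s \<omega>\<bar> \<le> (\<Sum>k = 1..N t \<omega>. \<bar>Xs k \<omega>\<bar>)" .
qed

lemma integral_sum_tendsto:
  fixes t \<alpha> :: real
  assumes "\<omega> \<in> space P" "0 < t" "0 \<le> \<alpha>"
  shows "(\<lambda>n. \<Sum>j<n. (LBINT s:{t * j / n<..t * Suc j / n}. (t - s) powr \<alpha>) *
      compound_sum N Xs (t * Suc j / n) \<omega>)
    \<longlonglongrightarrow> (LBINT s:{0..t}. compound_sum N Xs s \<omega> * (t - s) powr \<alpha>)"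
proof -
  obtain B where "\<And>s. 0 \<le> s \<Longrightarrow> s \<le> t \<Longrightarrow> \<bar>compound_sum N Xs s \<omega>\<bar> \<le> B"
    using compound_sum_bounded [OF assms(1), of t] by blast
  then have "(\<lambda>n. \<Sum>j<n. (LBINT s:{t * j / n<..t * Suc j / n}. (t - s) powr \<alpha>) *\<^sub>R
      compound_sum N Xs (t * Suc j / n) \<omega>)
    \<longlonglongrightarrow> (LBINT s:{0..t}. (t - s) powr \<alpha> *\<^sub>R compound_sum N Xs s \<omega>)"
    using assms by (intro right_riemann_sums_tendsto set_integrable_powr_diff
        compound_sum_right_continuous) auto
  then show ?thesis by (simp only: real_scaleR_def mult.commute [of "(t - s) powr \<alpha>" for s])
qed

text \<open>As a limit of the Riemann sums at every sample point, the integral inherits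
  measurability from finitely many values at a time; joint measurability in time and sample point
  never enters.\<close>

lemma weighted_integral_measurable:
  fixes t \<alpha> :: real
  assumes "0 \<le> t" "0 \<le> \<alpha>"
  shows "random_variable borel (\<lambda>\<omega>. LBINT s:{0..t}. compound_sum N Xs s \<omega> * (t - s) powr \<alpha>)"
proof (cases "t = 0")
  case True
  then show ?thesis by (simp only: set_integral_Icc_nonpos [OF eq_refl]) simp
next
  case False
  with assms have "0 < t" by simp
  then show ?thesis
    using assms by (intro borel_measurable_LIMSEQ_real [OF integral_sum_tendsto]
        borel_measurable_sum borel_measurable_times compound_sum_measurable) auto
qed

lemma jump_char_scaled_measurable [measurable]:
  "(\<lambda>v. jump_char (u * v powr a)) \<in> borel_measurable borel"
  using real_distribution.char_measurable [OF real_distribution_jump] by measurable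

lemma mixed_char_riemann:
  assumes "0 < a"
  shows "(\<lambda>n. \<Sum>j<n. (1 / n) *\<^sub>R jump_char (u * (Suc j / n) powr a)) \<longlonglongrightarrow> mixed_char a u"
proof -
  have "(\<lambda>n. \<Sum>j<n. (LBINT s:{1 * real j / n<..1 * real (Suc j) / n}. 1 :: real) *\<^sub>R jump_char (u * (1 * real (Suc j) / n) powr a))
    \<longlonglongrightarrow> (LBINT v:{0..1}. 1 *\<^sub>R jump_char (u * v powr a))"
  proof (rule right_riemann_sums_tendsto)
    show "set_integrable lborel {0..1::real} (\<lambda>_. 1 :: real)"
      by (simp add: set_integrable_def)
    fix s :: real assume s: "0 \<le> s"
    have "\<forall>\<^sub>F v in at_right s. 0 \<le> v"
      using s by (simp add: eventually_at_filter)
    \<comment> \<open>The base vanishes at s = 0; there the limit relies on approaching from the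
      right and on a > 0.\<close>
    then have "((\<lambda>v. v powr a) \<longlongrightarrow> s powr a) (at_right s)"
      using assms by (intro tendsto_powr' tendsto_intros) auto
    then show "continuous (at_right s) (\<lambda>v. jump_char (u * v powr a))"
      unfolding continuous_within
      by (intro isCont_tendsto_compose [OF real_distribution.isCont_char [OF real_distribution_jump]]
          tendsto_mult tendsto_const)
    show "norm (jump_char (u * s powr a)) \<le> 1"
      by (rule real_distribution.cmod_char_le_1 [OF real_distribution_jump])
  qed simp
  moreover have "(LBINT s:{1 * real j / n<..1 * real (Suc j) / n}. 1 :: real) = 1 / n" for j n :: nat
    by (simp add: set_lebesgue_integral_def divide_right_mono add_divide_distrib)
  ultimately show ?thesis by (simp add: mixed_char_def)
qed

text \<open>The characteristic functions of the Riemann sums have two limits that must agree: one by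
  dominated convergence along the paths, the other from their explicit exponential form.\<close>

lemma weighted_integral_char:
  fixes t \<alpha> u :: real
  assumes t: "0 < t" and \<alpha>: "0 \<le> \<alpha>"
  shows "expectation (\<lambda>\<omega>. iexp (u * (LBINT s:{0..t}. compound_sum N Xs s \<omega> * (t - s) powr \<alpha>))) =
    exp (rate * t * (mixed_char (\<alpha> + 1) (u * (t powr (\<alpha> + 1) / (\<alpha> + 1))) - 1))"
proof -
  let ?c = "\<lambda>(n::nat) (j::nat). LBINT s:{t * j / n<..t * Suc j / n}. (t - s) powr \<alpha>"
  let ?Y = "\<lambda>(n::nat) \<omega>. \<Sum>j<n. ?c n j * compound_sum N Xs (t * Suc j / n) \<omega>"
  let ?u = "u * (t powr (\<alpha> + 1) / (\<alpha> + 1))"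
  have Y_meas: "random_variable borel (?Y n)" for n
    using t by (intro borel_measurable_sum borel_measurable_times compound_sum_measurable) auto
  have "(\<lambda>n. expectation (\<lambda>\<omega>. iexp (u * ?Y n \<omega>))) \<longlonglongrightarrow>
      expectation (\<lambda>\<omega>. iexp (u * (LBINT s:{0..t}. compound_sum N Xs s \<omega> * (t - s) powr \<alpha>)))"
  proof (rule integral_dominated_convergence [where w = "\<lambda>_. 1"])
    show "AE \<omega> in P. (\<lambda>n. iexp (u * ?Y n \<omega>)) \<longlonglongrightarrow>
        iexp (u * (LBINT s:{0..t}. compound_sum N Xs s \<omega> * (t - s) powr \<alpha>))"
      by (intro AE_I2 isCont_tendsto_compose [OF isCont_iexp] tendsto_mult tendsto_const)
        (rule integral_sum_tendsto [OF _ t \<alpha>])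
    show "(\<lambda>\<omega>. iexp (u * (LBINT s:{0..t}. compound_sum N Xs s \<omega> * (t - s) powr \<alpha>))) \<in> borel_measurable P"
      using weighted_integral_measurable [of t \<alpha>] t \<alpha> by simp
    show "(\<lambda>\<omega>. iexp (u * ?Y n \<omega>)) \<in> borel_measurable P" for n
      using Y_meas [of n] by measurable
  qed auto
  moreover have "(\<lambda>n. expectation (\<lambda>\<omega>. iexp (u * ?Y n \<omega>))) \<longlonglongrightarrow>
      exp (rate * t * (mixed_char (\<alpha> + 1) ?u - 1))"
  proof (rule Lim_transform_eventually)
    show "(\<lambda>n. exp (rate * t * ((\<Sum>j<n. (1 / n) *\<^sub>R jump_char (?u * (Suc j / n) powr (\<alpha> + 1))) - 1))) \<longlonglongrightarrow>
        exp (rate * t * (mixed_char (\<alpha> + 1) ?u - 1))"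
      using \<alpha> by (intro tendsto_intros mixed_char_riemann) simp
    show "\<forall>\<^sub>F n in sequentially.
        exp (rate * t * ((\<Sum>j<n. (1 / n) *\<^sub>R jump_char (?u * (Suc j / n) powr (\<alpha> + 1))) - 1)) =
        expectation (\<lambda>\<omega>. iexp (u * ?Y n \<omega>))"
      using eventually_gt_at_top [of "0::nat"]
    proof eventually_elim
      case (elim n)
      let ?g = "\<lambda>j::nat. (t - t * j / n) powr (\<alpha> + 1) / (\<alpha> + 1)"
      have le: "t * j / n \<le> t" if "j \<le> n" for j
        using mult_left_le [of "j / n" t] t that elim by (simp add: field_simps)
      have c: "?c n j = - (?g (Suc j) - ?g j)" if "j < n" for j
        using set_lebesgue_integral_powr_diff [of \<alpha> "t * j / n" "t * Suc j / n" t] le [of "Suc j"] that t \<alpha>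
        by (simp add: divide_right_mono mult_left_mono)
      \<comment> \<open>Telescoping leaves \<open>?g j - ?g n\<close>, and the last term is 0
        because \<open>0 powr (\<alpha> + 1)\<close> is 0.\<close>
      have c_sum: "(\<Sum>i=j..<n. ?c n i) = ?g j" if "j < n" for j
      proof -
        have "(\<Sum>i=j..<n. ?c n i) = - (\<Sum>i=j..<n. ?g (Suc i) - ?g i)"
          unfolding sum_negf [symmetric] by (intro sum.cong refl c) auto
        also have "\<dots> = ?g j"
          using that elim by (subst sum_Suc_diff') auto
        finally show ?thesis .
      qed
      \<comment> \<open>Time reversal: counting cells from the end turns the left ends 0, ...,
        (n-1)/n into the right ends 1/n, ..., 1, as the Riemann sum for \<open>mixed_char\<close>
        requires.\<close>
      have g_rev: "u * ?g (n - Suc j) = ?u * (Suc j / n) powr (\<alpha> + 1)" if "j < n" for j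
      proof -
        have "t - t * real (n - Suc j) / n = t * (Suc j / n)"
          using that elim by (simp add: of_nat_diff right_diff_distrib diff_divide_distrib)
        then show ?thesis using t by (simp only: powr_mult) simp
      qed
      have width: "t * Suc j / n - t * j / n = t * (1 / n)" for j
        by (simp add: distrib_left add_divide_distrib)
      have "expectation (\<lambda>\<omega>. iexp (u * ?Y n \<omega>)) =
          exp (rate * (\<Sum>j<n. (t * Suc j / n - t * j / n) * (jump_char (u * (\<Sum>i=j..<n. ?c n i)) - 1)))"
        using t elim by (intro weighted_sum_char) (auto simp: field_simps)
      also have "(\<Sum>j<n. (t * Suc j / n - t * j / n) * (jump_char (u * (\<Sum>i=j..<n. ?c n i)) - 1)) =
          (\<Sum>j<n. of_real (t * (1 / n)) * (jump_char (u * ?g j) - 1))"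
        unfolding of_real_diff [symmetric] width by (intro sum.cong refl) (simp only: lessThan_iff c_sum)
      also have "\<dots> = (\<Sum>j<n. of_real (t * (1 / n)) * (jump_char (u * ?g (n - Suc j)) - 1))"
        by (rule sum.nat_diff_reindex [symmetric])
      also have "\<dots> = (\<Sum>j<n. of_real (t * (1 / n)) * (jump_char (?u * (Suc j / n) powr (\<alpha> + 1)) - 1))"
        by (intro sum.cong refl) (simp only: lessThan_iff g_rev)
      also have "\<dots> = of_real t * ((\<Sum>j<n. (1 / n) *\<^sub>R jump_char (?u * (Suc j / n) powr (\<alpha> + 1))) - 1)"
      proof -
        have "of_real (t * (1 / n)) * (z - 1) = of_real t * ((1 / n) *\<^sub>R z - of_real (1 / n))" for z :: complex
          by (simp add: scaleR_conv_of_real right_diff_distrib diff_divide_distrib)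
        moreover have "(\<Sum>j<n. of_real (1 / n)) = (1 :: complex)"
          using elim by simp
        ultimately show ?thesis
          by (simp only: sum_distrib_left [symmetric] sum_subtractf)
      qed
      finally show ?case by (simp only: mult.assoc of_real_mult)
    qed
  qed
  ultimately show ?thesis
    by (rule LIMSEQ_unique)
qed

section \<open>The sum with uniform factors\<close>

lemma uniform_sum_measurable:
  assumes "0 \<le> t" "\<And>k. 1 \<le> k \<Longrightarrow> random_variable borel (U k)"
  shows "random_variable borel (\<lambda>\<omega>. \<Sum>k = 1..N t \<omega>. Xs k \<omega> * U k \<omega> powr a)"
proof (rule measurable_compose_countable [OF _ count_measurable [OF assms(1)]], rule borel_measurable_sum)
  fix n k :: nat assume "k \<in> {1..n}"
  with jumps_measurable assms(2) have [measurable]: "random_variable borel (Xs k)" "random_variable borel (U k)"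
    by auto
  show "random_variable borel (\<lambda>\<omega>. Xs k \<omega> * U k \<omega> powr a)" by measurable
qed

text \<open>Fubini supplies the order of integration in which the uniform variable is averaged while
  the jump is held fixed.\<close>

lemma mixed_char_eq_jump_integral:
  "mixed_char a u =
    (\<integral>x. (\<integral>v. iexp (u * x * v powr a) \<partial>uniform_measure lborel {0<..<1}) \<partial>distr Q borel X)"
proof -
  interpret J: real_distribution "distr Q borel X" by (rule real_distribution_jump)
  interpret V: prob_space "uniform_measure lborel {0<..<1::real}"
    by (rule prob_space_uniform_measure) auto
  interpret JV: pair_prob_space "distr Q borel X" "uniform_measure lborel {0<..<1::real}" ..
  have "mixed_char a u = (\<integral>v. jump_char (u * v powr a) \<partial>uniform_measure lborel {0<..<1})"
    unfolding mixed_char_def by (simp add: integral_uniform_unit_interval)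
  also have "\<dots> = (\<integral>v. (\<integral>x. iexp (u * x * v powr a) \<partial>distr Q borel X) \<partial>uniform_measure lborel {0<..<1})"
    unfolding char_def by (simp add: ac_simps)
  also have "\<dots> = (\<integral>x. (\<integral>v. iexp (u * x * v powr a) \<partial>uniform_measure lborel {0<..<1}) \<partial>distr Q borel X)"
    by (intro JV.Fubini_integral JV.P.integrable_const_bound [where B = 1]) (auto simp: split_beta')
  finally show ?thesis .
qed

text \<open>The uniform variables are averaged before the jumps because they are independent of path
  and jumps jointly, whereas the jumps are independent of the path. What remains is a power with
  exponent N(t), whose mean is the Poisson generating function.\<close>

lemma uniform_sum_char:
  assumes t: "0 < t"
    and U_indep: "indep_vars (\<lambda>_. borel) U {1..}"
    and U_uniform: "\<And>k. 1 \<le> k \<Longrightarrow> distr P borel (U k) = uniform_measure lborel {0<..<1}"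
    and U_indep_N_X: "indep_elements (path_space \<Otimes>\<^sub>M seq_space)
      (\<lambda>\<omega>. (count_path N \<omega>, rv_seq Xs \<omega>)) seq_space (rv_seq U)"
  shows "expectation (\<lambda>\<omega>. iexp (u * (\<Sum>k = 1..N t \<omega>. Xs k \<omega> * U k \<omega> powr a))) =
    exp (rate * t * (mixed_char a u - 1))"
proof -
  \<comment> \<open>The characteristic function of V^a at u x. Being bounded by 1, it can serve as
    the factor in the second round of averaging.\<close>
  define \<kappa> where "\<kappa> x = (\<integral>v. iexp (u * x * v powr a) \<partial>uniform_measure lborel {0<..<1})" for x
  interpret V: prob_space "uniform_measure lborel {0<..<1::real}"
    by (rule prob_space_uniform_measure) auto
  have \<kappa>_meas [measurable]: "\<kappa> \<in> borel_measurable borel"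
    unfolding \<kappa>_def [abs_def] by measurable
  have \<kappa>_bound: "norm (\<kappa> x) \<le> 1" for x
  proof -
    have "norm (\<kappa> x) \<le> (\<integral>v. norm (iexp (u * x * v powr a)) \<partial>uniform_measure lborel {0<..<1})"
      unfolding \<kappa>_def by (rule integral_norm_bound)
    then show ?thesis by (simp add: V.prob_space)
  qed
  have coord: "(\<lambda>z. z t) \<in> measurable path_space (count_space UNIV)"
    using t by (intro measurable_component_singleton) auto
  have "expectation (\<lambda>\<omega>. iexp (u * (\<Sum>k = 1..N t \<omega>. Xs k \<omega> * U k \<omega> powr a))) =
      expectation (\<lambda>\<omega>. \<Prod>k = 1..count_path N \<omega> t. iexp (u * rv_seq Xs \<omega> k * U k \<omega> powr a))"
    using t by (intro Bochner_Integration.integral_cong refl)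
      (simp add: sum_distrib_left exp_sum [symmetric] mult.assoc cong: prod.cong_simp)
  also have "\<dots> = expectation (\<lambda>\<omega>. \<Prod>k = 1..count_path N \<omega> t.
      \<integral>v. iexp (u * rv_seq Xs \<omega> k * v powr a) \<partial>distr P borel (U k))"
  proof (rule indep_elements_random_prod [where Z = "\<lambda>\<omega>. (count_path N \<omega>, rv_seq Xs \<omega>)"
        and m = "\<lambda>z. fst z t" and h = "\<lambda>k z v. iexp (u * snd z k * v powr a)",
        OF U_indep_N_X U_indep, simplified fst_conv snd_conv])
    show "(\<lambda>z. fst z t) \<in> measurable (path_space \<Otimes>\<^sub>M seq_space) (count_space UNIV)"
      by (rule measurable_compose [OF measurable_fst coord])
    fix k :: nat assume "1 \<le> k"
    then have "(\<lambda>z. z k) \<in> borel_measurable seq_space"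
      by (intro measurable_component_singleton) auto
    then have [measurable]: "(\<lambda>p. snd (fst p) k) \<in> borel_measurable ((path_space \<Otimes>\<^sub>M seq_space) \<Otimes>\<^sub>M borel)"
      by (rule measurable_compose [OF measurable_compose [OF measurable_fst measurable_snd]])
    show "(\<lambda>(z, v). iexp (u * snd z k * v powr a)) \<in>
        borel_measurable ((path_space \<Otimes>\<^sub>M seq_space) \<Otimes>\<^sub>M borel)"
      unfolding split_beta' by measurable
  qed auto
  also have "\<dots> = expectation (\<lambda>\<omega>. \<Prod>k = 1..count_path N \<omega> t. \<kappa> (Xs k \<omega>))"
    by (intro Bochner_Integration.integral_cong prod.cong refl) (auto simp: \<kappa>_def U_uniform)
  also have "\<dots> = expectation (\<lambda>\<omega>. \<Prod>k = 1..count_path N \<omega> t. \<integral>x. \<kappa> x \<partial>distr P borel (Xs k))"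
    by (rule indep_elements_random_prod [where Z = "count_path N" and m = "\<lambda>z. z t"
        and h = "\<lambda>k z x. \<kappa> x", OF jumps_indep_count jumps_indep coord]) (auto simp: \<kappa>_bound)
  also have "\<dots> = expectation (\<lambda>\<omega>. \<Prod>k = 1..count_path N \<omega> t. mixed_char a u)"
    by (intro Bochner_Integration.integral_cong prod.cong refl)
      (auto simp: jumps_distr mixed_char_eq_jump_integral \<kappa>_def)
  also have "\<dots> = expectation (\<lambda>\<omega>. mixed_char a u ^ (N t \<omega> - N 0 \<omega>))"
    using t by (intro Bochner_Integration.integral_cong refl) (simp add: start_zero)
  also have "\<dots> = exp (rate * t * (mixed_char a u - 1))"
    using increment_pgf [of 0 t] t by simp
  finally show ?thesis .
qed

text \<open>The integrands differ at \<open>s = t\<close>, as \<open>0 powr 0 = 0\<close>.\<close>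

lemma integral_eq_weighted:
  fixes t :: real
  assumes \<omega>: "\<omega> \<in> space P" and t: "0 < t"
  shows "(LBINT s:{0..t}. compound_sum N Xs s \<omega>) = (LBINT s:{0..t}. compound_sum N Xs s \<omega> * (t - s) powr 0)"
proof (rule LIMSEQ_unique)
  obtain B where "\<And>s. 0 \<le> s \<Longrightarrow> s \<le> t \<Longrightarrow> \<bar>compound_sum N Xs s \<omega>\<bar> \<le> B"
    using compound_sum_bounded [OF \<omega>, of t] by blast
  then have "(\<lambda>n. \<Sum>j<n. (LBINT s:{t * j / n<..t * Suc j / n}. 1) *\<^sub>R compound_sum N Xs (t * Suc j / n) \<omega>)
    \<longlonglongrightarrow> (LBINT s:{0..t}. 1 *\<^sub>R compound_sum N Xs s \<omega>)"
    using t by (intro right_riemann_sums_tendsto compound_sum_right_continuous \<omega>)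
      (auto simp: set_integrable_def)
  then show "(\<lambda>n. \<Sum>j<n. (LBINT s:{t * j / n<..t * Suc j / n}. 1) * compound_sum N Xs (t * Suc j / n) \<omega>)
    \<longlonglongrightarrow> (LBINT s:{0..t}. compound_sum N Xs s \<omega>)"
    by simp
  \<comment> \<open>Both integrals are limits of the same Riemann sums, since the two weights differ
    at most at the null point s = t.\<close>
  have weight: "(LBINT s:{t * j / n<..t * Suc j / n}. (t - s) powr 0) = (LBINT s:{t * j / n<..t * Suc j / n}. 1)"
    for j n :: nat
    unfolding set_lebesgue_integral_def
    by (rule integral_cong_AE, measurable, use AE_lborel_singleton [of t] in eventually_elim) auto
  show "(\<lambda>n. \<Sum>j<n. (LBINT s:{t * j / n<..t * Suc j / n}. 1) * compound_sum N Xs (t * Suc j / n) \<omega>)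
    \<longlonglongrightarrow> (LBINT s:{0..t}. compound_sum N Xs s \<omega> * (t - s) powr 0)"
    using integral_sum_tendsto [OF \<omega> t, of 0] by (simp only: weight order_refl simp_thms)
qed

lemma integral_measurable:
  fixes t :: real
  shows "random_variable borel (\<lambda>\<omega>. LBINT s:{0..t}. compound_sum N Xs s \<omega>)"
proof (cases "0 < t")
  case True
  with weighted_integral_measurable [of t 0] integral_eq_weighted [OF _ True]
  show ?thesis by (simp cong: measurable_cong_simp)
next
  case False
  then show ?thesis by (simp add: set_integral_Icc_nonpos)
qed

lemma integral_char:
  fixes t c u :: real
  assumes t: "0 < t"
  shows "expectation (\<lambda>\<omega>. iexp (u * (c * (LBINT s:{0..t}. compound_sum N Xs s \<omega>)))) =
    exp (rate * t * (mixed_char 1 (u * c * t) - 1))"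
proof -
  have "expectation (\<lambda>\<omega>. iexp (u * (c * (LBINT s:{0..t}. compound_sum N Xs s \<omega>)))) =
      expectation (\<lambda>\<omega>. iexp (u * c * (LBINT s:{0..t}. compound_sum N Xs s \<omega> * (t - s) powr 0)))"
    by (intro Bochner_Integration.integral_cong refl) (simp only: integral_eq_weighted [OF _ t] mult.assoc)
  then show ?thesis
    using weighted_integral_char [OF t, of 0 "u * c"] t by simp
qed

section \<open>Second-order expansion and scaling limits\<close>

text \<open>The expansion of \<open>jump_char\<close> at u v / sqrt r is integrated over v in the
  unit interval, dominated by its bound at v = 1. The constant 6 is the 2 of the Taylor term times
  the 3 from the integral of v^2.\<close>

lemma mixed_char_second_order:
  assumes int: "integrable Q (\<lambda>x. (X x)\<^sup>2)" and mean: "(\<integral>x. X x \<partial>Q) = 0"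
  shows "((\<lambda>r. of_real r * (mixed_char 1 (u / sqrt r) - 1)) \<longlongrightarrow>
    - of_real (u\<^sup>2 * (\<integral>x. (X x)\<^sup>2 \<partial>Q) / 6)) at_top"
proof -
  let ?\<sigma>2 = "\<integral>x. (X x)\<^sup>2 \<partial>Q"
  interpret J: real_distribution "distr Q borel X" by (rule real_distribution_jump)
  have J: "integrable (distr Q borel X) (\<lambda>x. x\<^sup>2)" "J.expectation (\<lambda>x. x) = 0"
    "J.expectation (\<lambda>x. x\<^sup>2) = ?\<sigma>2"
    using int mean jump_measurable by (simp_all add: integrable_distr_eq integral_distr)
  note so = J.char_second_order_tendsto [OF J(1,2), unfolded J(3)]
  let ?f = "\<lambda>r v. indicator {0..1} v *\<^sub>R (of_real r * (jump_char (u * v / sqrt r) - 1))"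
  let ?g = "\<lambda>v. indicator {0..1} v *\<^sub>R (- complex_of_real ((u * v)\<^sup>2 * ?\<sigma>2 / 2))"
  have char_meas [measurable]: "jump_char \<in> borel_measurable borel"
    by (rule J.char_measurable)
  have "((\<lambda>r. \<integral>v. ?f r v \<partial>lborel) \<longlongrightarrow> (\<integral>v. ?g v \<partial>lborel)) at_top"
  proof (rule integral_dominated_convergence_at_top [where w = "\<lambda>v. indicator {0..1} v *\<^sub>R (2 * u\<^sup>2 * ?\<sigma>2)"])
    show "\<forall>\<^sub>F r in at_top. AE v in lborel. norm (?f r v) \<le> indicator {0..1} v *\<^sub>R (2 * u\<^sup>2 * ?\<sigma>2)"
    proof (rule eventually_mono [OF eventually_gt_at_top [of "0::real"]], intro AE_I2)
      fix r v :: real assume r: "0 < r"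
      show "norm (?f r v) \<le> indicator {0..1} v *\<^sub>R (2 * u\<^sup>2 * ?\<sigma>2)"
      proof (cases "v \<in> {0..1}")
        case True
        then have "(u * v)\<^sup>2 \<le> u\<^sup>2"
          by (auto simp: power_mult_distrib intro!: mult_left_le power_le_one)
        then have "2 * (u * v)\<^sup>2 * ?\<sigma>2 \<le> 2 * u\<^sup>2 * ?\<sigma>2"
          by (intro mult_right_mono) auto
        with so(2) [OF r, of "u * v"] True show ?thesis by simp
      qed simp
    qed
    show "AE v in lborel. ((\<lambda>r. ?f r v) \<longlongrightarrow> ?g v) at_top"
      by (intro AE_I2 tendsto_scaleR tendsto_const so(1))
  qed measurable
  moreover have "(\<integral>v. ?g v \<partial>lborel) = - of_real (u\<^sup>2 * ?\<sigma>2 / 6)"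
  proof -
    have third: "(\<integral>v. indicator {0..1} v * v\<^sup>2 \<partial>lborel) = (1 / 3 :: real)"
      using integral_power [of 0 1 2] by (simp add: mult.commute)
    have "?g v = of_real (- (u\<^sup>2 * ?\<sigma>2 / 2) * (indicator {0..1} v * v\<^sup>2))" for v
      by (simp add: indicator_def power_mult_distrib)
    then have "(\<integral>v. ?g v \<partial>lborel) = of_real (- (u\<^sup>2 * ?\<sigma>2 / 2) * (1 / 3))"
      by (simp only: integral_complex_of_real Bochner_Integration.integral_mult_right_zero third)
    then show ?thesis by simp
  qed
  moreover have "(\<integral>v. ?f r v \<partial>lborel) = of_real r * (mixed_char 1 (u / sqrt r) - 1)" for r
  proof -
    have int_char: "integrable lborel (\<lambda>v. indicator {0..1} v *\<^sub>R jump_char (u / sqrt r * v powr 1))"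
      by (rule Bochner_Integration.integrable_bound [of lborel "indicator {0..1} :: real \<Rightarrow> real"])
        (auto simp: indicator_def J.cmod_char_le_1)
    have "(\<integral>v. ?f r v \<partial>lborel) = (\<integral>v. of_real r *
        (indicator {0..1} v *\<^sub>R jump_char (u / sqrt r * v powr 1) - of_real (indicator {0..1} v)) \<partial>lborel)"
      by (intro Bochner_Integration.integral_cong refl) (auto simp: indicator_def)
    also have "\<dots> = of_real r * (mixed_char 1 (u / sqrt r) - 1)"
      using int_char by (simp add: mixed_char_def set_lebesgue_integral_def Bochner_Integration.integral_diff)
    finally show ?thesis .
  qed
  ultimately show ?thesis by (simp only:)
qed

text \<open>Scaling by t^(-3/2) puts u / sqrt t into \<open>mixed_char 1\<close>, and the factor t
  in the exponent is exactly the one the expansion needs. Scaling by t^(-2) puts in u / t, for which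
  the expansion with r = t^2 needs t^2; only t is present, so the exponent vanishes in the
  limit.\<close>

lemma scaled_integral_limits:
  assumes int: "integrable Q (\<lambda>x. (X x)\<^sup>2)" and mean: "(\<integral>x. X x \<partial>Q) = 0"
  shows "tendsto_in_probability P (\<lambda>t \<omega>. 1 / t\<^sup>2 * (LBINT s:{0..t}. compound_sum N Xs s \<omega>)) (\<lambda>_. 0) at_top"
    and "tendsto_in_distribution P (\<lambda>t \<omega>. 1 / t powr (3/2) * (LBINT s:{0..t}. compound_sum N Xs s \<omega>))
      (normal_law 0 (rate * (\<integral>x. (X x)\<^sup>2 \<partial>Q) / 3)) at_top"
proof -
  let ?I = "\<lambda>(t::real) \<omega>. LBINT s:{0..t}. compound_sum N Xs s \<omega>"
  let ?v = "rate * (\<integral>x. (X x)\<^sup>2 \<partial>Q) / 3"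
  have v: "0 \<le> ?v" using rate_pos by simp
  have meas [measurable]: "random_variable borel (?I t)" for t by (rule integral_measurable)
  note so = mixed_char_second_order [OF int mean]
  show "tendsto_in_distribution P (\<lambda>t \<omega>. 1 / t powr (3/2) * ?I t \<omega>) (normal_law 0 ?v) at_top"
  proof (rule tendsto_in_distributionI_char)
    fix u
    show "((\<lambda>t. expectation (\<lambda>\<omega>. iexp (u * (1 / t powr (3/2) * ?I t \<omega>)))) \<longlongrightarrow> char (normal_law 0 ?v) u) at_top"
    proof (rule Lim_transform_eventually)
      have "((\<lambda>t. exp (rate * (of_real t * (mixed_char 1 (u / sqrt t) - 1)))) \<longlongrightarrow>
          exp (rate * - complex_of_real (u\<^sup>2 * (\<integral>x. (X x)\<^sup>2 \<partial>Q) / 6))) at_top"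
        by (intro tendsto_exp tendsto_mult tendsto_const so)
      \<comment> \<open>Writing 1/6 as half of 1/3 identifies the variance as a third of
        \<open>rate\<close> times the second moment.\<close>
      also have "exp (rate * - complex_of_real (u\<^sup>2 * (\<integral>x. (X x)\<^sup>2 \<partial>Q) / 6)) = char (normal_law 0 ?v) u"
        unfolding normal_law_char(2) [OF v] exp_of_real [symmetric]
        by (rule arg_cong [where f = exp]) simp
      finally show "((\<lambda>t. exp (rate * (of_real t * (mixed_char 1 (u / sqrt t) - 1)))) \<longlongrightarrow>
          char (normal_law 0 ?v) u) at_top" .
      show "\<forall>\<^sub>F t in at_top. exp (rate * (of_real t * (mixed_char 1 (u / sqrt t) - 1))) =
          expectation (\<lambda>\<omega>. iexp (u * (1 / t powr (3/2) * ?I t \<omega>)))"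
        using eventually_gt_at_top [of "0::real"]
      proof eventually_elim
        case (elim t)
        have "t powr (3/2) = t powr (1 + 1/2)" by simp
        also have "\<dots> = t * sqrt t"
          using elim by (simp only: powr_add powr_half_sqrt) simp
        finally have "u * (1 / t powr (3/2)) * t = u / sqrt t"
          using elim by simp
        with integral_char [OF elim, of u "1 / t powr (3/2)"] show ?case
          by (simp only: mult.assoc of_real_mult)
      qed
    qed
  qed (use normal_law_char(1) [OF v] in \<open>auto intro: borel_measurable_times\<close>)
  have "tendsto_in_distribution P (\<lambda>t \<omega>. 1 / t\<^sup>2 * ?I t \<omega>) (return borel 0) at_top"
  proof (rule tendsto_in_distributionI_char)
    show "real_distribution (return borel (0::real))"
      using normal_law_char(1) [of 0] by (simp add: normal_law_def)
    fix u
    \<comment> \<open>The square root of t^2 is kept unevaluated so that the expansion applies with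
      r = t^2; the surplus 1 / t tends to 0.\<close>
    have "((\<lambda>t. of_real (1 / t) * (of_real (t\<^sup>2) * (mixed_char 1 (u / sqrt (t\<^sup>2)) - 1))) \<longlongrightarrow>
        of_real 0 * - of_real (u\<^sup>2 * (\<integral>x. (X x)\<^sup>2 \<partial>Q) / 6)) at_top"
      by (intro tendsto_mult tendsto_of_real tendsto_divide_0 [OF tendsto_const]
          filterlim_at_top_imp_at_infinity filterlim_ident
          filterlim_compose [OF so] filterlim_pow_at_top) simp
    then have "((\<lambda>t. exp (rate * (of_real (1 / t) * (of_real (t\<^sup>2) * (mixed_char 1 (u / sqrt (t\<^sup>2)) - 1)))))
        \<longlongrightarrow> exp (complex_of_real rate * 0)) at_top"
      by (intro tendsto_exp tendsto_mult tendsto_const) simp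
    then have lim: "((\<lambda>t. exp (rate * (of_real (1 / t) * (of_real (t\<^sup>2) * (mixed_char 1 (u / sqrt (t\<^sup>2)) - 1)))))
        \<longlongrightarrow> char (return borel 0) u) at_top"
      using normal_law_char(2) [of 0 u] by (simp add: normal_law_def)
    show "((\<lambda>t. expectation (\<lambda>\<omega>. iexp (u * (1 / t\<^sup>2 * ?I t \<omega>)))) \<longlongrightarrow> char (return borel 0) u) at_top"
    proof (rule Lim_transform_eventually [OF lim])
      show "\<forall>\<^sub>F t in at_top. exp (rate * (of_real (1 / t) * (of_real (t\<^sup>2) * (mixed_char 1 (u / sqrt (t\<^sup>2)) - 1)))) =
          expectation (\<lambda>\<omega>. iexp (u * (1 / t\<^sup>2 * ?I t \<omega>)))"
        using eventually_gt_at_top [of "0::real"]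
      proof eventually_elim
        case (elim t)
        have "u * (1 / t\<^sup>2) * t = u / sqrt (t\<^sup>2)"
          using elim by (simp add: power2_eq_square)
        moreover have "complex_of_real (1 / t) * of_real (t\<^sup>2) = of_real t"
          using elim by (simp add: power2_eq_square)
        ultimately show ?case
          using integral_char [OF elim, of u "1 / t\<^sup>2"]
          by (simp only: mult.assoc [symmetric] of_real_mult)
      qed
    qed
  qed measurable
  then show "tendsto_in_probability P (\<lambda>t \<omega>. 1 / t\<^sup>2 * ?I t \<omega>) (\<lambda>_. 0) at_top"
    by (intro tendsto_in_probability_zeroI) measurable
qed

end

theorem mainTheorem11:
  fixes P :: "'a measure" and Q :: "'b measure" and rate :: real
    and N :: "real \<Rightarrow> 'a \<Rightarrow> nat" and X :: "'b \<Rightarrow> real"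
    and Xs U :: "nat \<Rightarrow> 'a \<Rightarrow> real" and M :: "real \<Rightarrow> 'a \<Rightarrow> real"
  assumes CP: "compound_poisson P rate N Q X Xs"
    and M: "M = compound_sum N Xs"
    and U_indep: "prob_space.indep_vars P (\<lambda>_. borel) U {1..}"
    and U_uniform: "\<And>k. 1 \<le> k \<Longrightarrow> distr P borel (U k) = uniform_measure lborel {0<..<1}"
    and U_indep_N_X: "prob_space.indep_elements P
      (path_space \<Otimes>\<^sub>M seq_space) (\<lambda>\<omega>. (count_path N \<omega>, rv_seq Xs \<omega>)) seq_space (rv_seq U)"
  shows "(\<forall>t\<ge>0. \<forall>\<alpha>\<ge>0. eq_in_distribution
            P (\<lambda>\<omega>. LBINT s:{0..t}. M s \<omega> * (t - s) powr \<alpha>)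
            P (\<lambda>\<omega>. t powr (\<alpha> + 1) / (\<alpha> + 1) * (\<Sum>k = 1..N t \<omega>. Xs k \<omega> * U k \<omega> powr (\<alpha> + 1)))) \<and>
    (integrable Q (\<lambda>x. (X x)\<^sup>2) \<and> (\<integral>x. X x \<partial>Q) = 0 \<longrightarrow>
        tendsto_in_probability
          P (\<lambda>t \<omega>. 1 / t\<^sup>2 * (LBINT s:{0..t}. M s \<omega>)) (\<lambda>_. 0) at_top \<and>
        tendsto_in_distribution
          P (\<lambda>t \<omega>. 1 / t powr (3/2) * (LBINT s:{0..t}. M s \<omega>))
          (normal_law 0 (rate * (\<integral>x. (X x)\<^sup>2 \<partial>Q) / 3)) at_top)"
proof -
  interpret compound_poisson P rate N Q X Xs by (rule CP)
  have U_meas: "random_variable borel (U k)" if "1 \<le> k" for k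
    using U_indep that by (auto simp: indep_vars_def)
  have "eq_in_distribution
      P (\<lambda>\<omega>. LBINT s:{0..t}. M s \<omega> * (t - s) powr \<alpha>)
      P (\<lambda>\<omega>. t powr (\<alpha> + 1) / (\<alpha> + 1) * (\<Sum>k = 1..N t \<omega>. Xs k \<omega> * U k \<omega> powr (\<alpha> + 1)))"
    if t: "0 \<le> t" and \<alpha>: "0 \<le> \<alpha>" for t \<alpha>
  proof (rule eq_in_distributionI_char)
    show "random_variable borel (\<lambda>\<omega>. LBINT s:{0..t}. M s \<omega> * (t - s) powr \<alpha>)"
      unfolding M by (rule weighted_integral_measurable [OF t \<alpha>])
    show "random_variable borel (\<lambda>\<omega>. t powr (\<alpha> + 1) / (\<alpha> + 1) *
        (\<Sum>k = 1..N t \<omega>. Xs k \<omega> * U k \<omega> powr (\<alpha> + 1)))"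
      by (intro borel_measurable_times borel_measurable_const uniform_sum_measurable t U_meas)
    fix u
    show "expectation (\<lambda>\<omega>. iexp (u * (LBINT s:{0..t}. M s \<omega> * (t - s) powr \<alpha>))) =
        expectation (\<lambda>\<omega>. iexp (u * (t powr (\<alpha> + 1) / (\<alpha> + 1) *
          (\<Sum>k = 1..N t \<omega>. Xs k \<omega> * U k \<omega> powr (\<alpha> + 1)))))"
    proof (cases "t = 0")
      \<comment> \<open>Both sides are 0: the integral is over a null set, and
        \<open>0 powr (\<alpha> + 1)\<close> is 0.\<close>
      case True
      then show ?thesis
        by (simp only: set_integral_Icc_nonpos [OF eq_refl]) simp
    next
      case False
      with t have "0 < t" by simp
      then show ?thesis
        using weighted_integral_char [of t \<alpha> u] \<alpha>
          uniform_sum_char [OF _ U_indep U_uniform U_indep_N_X, of t "u * (t powr (\<alpha> + 1) / (\<alpha> + 1))" "\<alpha> + 1"]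
        unfolding M by (simp only: mult.assoc simp_thms)
    qed
  qed
  then show ?thesis
    using scaled_integral_limits unfolding M by blast
qed

end
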